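(* Let $G_1$ and $G_2$ be finite graphs, viewed as metric graphs with all edges of length $1$. Consider the optimal scale factor $\alpha$, the smallest $\alpha>0$ such that $G_1$ with every edge length multiplied by $\alpha$ can be folded onto $G_2$ via an isometric covering. This $\alpha$ is a rational number.
   Context: A metric graph is viewed as a metric space in which each edge is a segment of its length, glued at the vertices. An isometric covering (folding) of $Y$ by $X$ is a surjective map $m:X\to Y$ such that, for every path $p$ in $X$, the arc length of $p$ equals the arc length of the curve $m(p)$ in $Y$, counted with multiplicity. *)

theory Defs
  imports Complex_Main "HOL-Library.Extended_Real"
begin

record ('v, 'e) graph =
  verts :: "'v set"
  edges :: "'e set"
  src :: "'e \<Rightarrow> 'v"
  tgt :: "'e \<Rightarrow> 'v"

definition finite_graph :: "('v, 'e) graph \<Rightarrow> bool" where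
  "finite_graph G \<longleftrightarrow> finite (verts G) \<and> finite (edges G) \<and>
     (\<forall>e\<in>edges G. src G e \<in> verts G \<and> tgt G e \<in> verts G)"

datatype ('v, 'e) gpt = Vert 'v | EdgePt 'e real

definition gpoints :: "('v, 'e) graph \<Rightarrow> ('e \<Rightarrow> real) \<Rightarrow> ('v, 'e) gpt set" where
  "gpoints G l = Vert ` verts G \<union> {EdgePt e t | e t. e \<in> edges G \<and> 0 < t \<and> t < l e}"

definition gpos :: "('v, 'e) graph \<Rightarrow> ('e \<Rightarrow> real) \<Rightarrow> 'e \<Rightarrow> real \<Rightarrow> ('v, 'e) gpt" where
  "gpos G l e t = (if t \<le> 0 then Vert (src G e) else if l e \<le> t then Vert (tgt G e) else EdgePt e t)"

text \<open>Chains of moves along edges; the gluing (quotient) metric is the infimum of their costs.\<close>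
inductive gchain :: "('v, 'e) graph \<Rightarrow> ('e \<Rightarrow> real) \<Rightarrow> ('v, 'e) gpt \<Rightarrow> ('v, 'e) gpt \<Rightarrow> real \<Rightarrow> bool"
  for G l where
  refl: "x \<in> gpoints G l \<Longrightarrow> gchain G l x x 0"
| step: "\<lbrakk>e \<in> edges G; 0 \<le> s; s \<le> l e; 0 \<le> t; t \<le> l e; gchain G l (gpos G l e t) z c\<rbrakk>
         \<Longrightarrow> gchain G l (gpos G l e s) z (\<bar>s - t\<bar> + c)"

definition gdist :: "('v, 'e) graph \<Rightarrow> ('e \<Rightarrow> real) \<Rightarrow> ('v, 'e) gpt \<Rightarrow> ('v, 'e) gpt \<Rightarrow> ereal" where
  "gdist G l x y = Inf {ereal c | c. gchain G l x y c}"

definition arclen :: "('v, 'e) graph \<Rightarrow> ('e \<Rightarrow> real) \<Rightarrow> (real \<Rightarrow> ('v, 'e) gpt) \<Rightarrow> ereal" where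
  "arclen G l p = (SUP ts \<in> {ts. sorted ts \<and> set ts \<subseteq> {0..1}}.
      sum_list (map (\<lambda>(a, b). gdist G l (p a) (p b)) (zip ts (tl ts))))"

definition gpath :: "('v, 'e) graph \<Rightarrow> ('e \<Rightarrow> real) \<Rightarrow> (real \<Rightarrow> ('v, 'e) gpt) \<Rightarrow> bool" where
  "gpath G l p \<longleftrightarrow> p ` {0..1} \<subseteq> gpoints G l \<and>
     (\<forall>t\<in>{0..1}. \<forall>\<epsilon>>0. \<exists>\<delta>>0. \<forall>s\<in>{0..1}. \<bar>s - t\<bar> < \<delta> \<longrightarrow> gdist G l (p s) (p t) < ereal \<epsilon>)"

definition iso_cover :: "('v, 'e) graph \<Rightarrow> ('e \<Rightarrow> real) \<Rightarrow> ('w, 'f) graph \<Rightarrow> ('f \<Rightarrow> real)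
    \<Rightarrow> (('v, 'e) gpt \<Rightarrow> ('w, 'f) gpt) \<Rightarrow> bool" where
  "iso_cover G l H l' m \<longleftrightarrow> m ` gpoints G l = gpoints H l' \<and>
     (\<forall>p. gpath G l p \<longrightarrow> arclen H l' (m \<circ> p) = arclen G l p)"

end

theory Submission
  imports Defs
begin

text \<open>Every edge of the source is mapped to a \<open>1\<close>-Lipschitz path of length \<open>\<alpha>\<close>. Locally, such a path
  can be replaced by finitely many straight moves that cover the same set and are not longer;
  a bisection argument makes this global, so that the folding is described by finitely many
  coordinates on the target, subject to linear conditions with rational coefficients. If \<open>\<alpha>\<close> were
  irrational, there would be an additive \<open>\<psi>\<close> on the reals with \<open>\<psi> 1 = 0\<close> and \<open>\<psi> \<alpha> = -1\<close>. Moving every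
  coordinate \<open>t\<close> to \<open>t + \<epsilon> * \<psi> t\<close> for a small \<open>\<epsilon> > 0\<close> preserves all these conditions and replaces
  \<open>\<alpha>\<close> by \<open>\<alpha> - \<epsilon>\<close>; slack in length is used up by running back and forth, which gives an
  isometric covering with a smaller factor.\<close>

subsection \<open>The gluing metric\<close>

text \<open>The functional \<psi> is necessarily discontinuous, since a continuous additive function
  that vanishes at 1 is 0. So it cannot be applied along a path, which may moreover turn infinitely
  often. This forces the passage to trails: on the finite set of their coordinates a small
  \<epsilon> keeps the strict order, and only these coordinates are moved.
  \<open>\<psi> 1 = 0\<close> fixes both ends of every target edge, so the gluing survives.
  \<open>\<psi> \<alpha> = -1\<close> lowers the available length; a trail of length exactly
  \<alpha> shrinks by the same amount, and a shorter one has room if \<epsilon> is small. The arc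
  length condition itself is not carried through the perturbation. Only surjectivity, a Lipschitz
  bound and nonconstancy on edges are extracted from it, and it is rebuilt at the end from unit
  speed paths. As folds must be allowed, unit speed is demanded only radially around each time; this
  weak local condition already determines arc length.\<close>

lemma abs_min_diff_le: "\<lbrakk>\<bar>a - c\<bar> \<le> e; \<bar>b - d\<bar> \<le> e\<rbrakk> \<Longrightarrow> \<bar>min a b - min c d\<bar> \<le> (e::real)"
  by linarith

lemma abs_max_diff_le: "\<lbrakk>\<bar>a - c\<bar> \<le> e; \<bar>b - d\<bar> \<le> e\<rbrakk> \<Longrightarrow> \<bar>max a b - max c d\<bar> \<le> (e::real)"
  by linarith

text \<open>The function is a tent of slope \<open>k\<close> with feet at 0 and \<open>A\<close>,
  extended by 0. Test functions supported on a star are assembled from such tents.\<close>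

lemma tent_lipschitz:
  fixes k :: real
  assumes "\<bar>k\<bar> \<le> 1"
  shows "\<bar>k * max 0 (min s (A - s)) - k * max 0 (min t (A - t))\<bar> \<le> \<bar>s - t\<bar>"
proof -
  let ?h = "\<lambda>t. max 0 (min t (A - t))"
  have "\<bar>k * ?h s - k * ?h t\<bar> = \<bar>k\<bar> * \<bar>?h s - ?h t\<bar>" by (simp add: abs_mult flip: right_diff_distrib)
  also have "\<dots> \<le> \<bar>?h s - ?h t\<bar>" using assms by (simp add: mult_left_le_one_le)
  also have "\<dots> \<le> \<bar>s - t\<bar>" by (intro abs_max_diff_le abs_min_diff_le) auto
  finally show ?thesis .
qed

lemma ereal_between_less: "\<lbrakk>ereal a \<le> g; g < ereal b\<rbrakk> \<Longrightarrow> a < b"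
  by (metis le_less_trans less_ereal.simps(1))

text \<open>Serves both sides of a covering: the source with the scale factor as edge length, the
  target with 1.\<close>

locale equilateral_graph =
  fixes G :: "('v, 'e) graph" and L :: real
  assumes fin: "finite_graph G" and L_pos: "L > 0"
begin

abbreviation pts where "pts \<equiv> gpoints G (\<lambda>_. L)"
abbreviation pos where "pos \<equiv> gpos G (\<lambda>_. L)"
abbreviation chain where "chain \<equiv> gchain G (\<lambda>_. L)"
abbreviation gd where "gd \<equiv> gdist G (\<lambda>_. L)"

lemma finite_edges: "finite (edges G)"
  using fin by (simp add: finite_graph_def)

lemma pos_in_pts: "f \<in> edges G \<Longrightarrow> pos f t \<in> pts"
  using fin by (auto simp: gpos_def gpoints_def finite_graph_def)

lemma pos_0 [simp]: "pos f 0 = Vert (src G f)"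
  and pos_L [simp]: "pos f L = Vert (tgt G f)"
  using L_pos by (auto simp: gpos_def)

lemma pos_interior: "0 < t \<Longrightarrow> t < L \<Longrightarrow> pos f t = EdgePt f t"
  by (auto simp: gpos_def)

lemma chain_trans: "chain x y c \<Longrightarrow> chain y z d \<Longrightarrow> chain x z (c + d)"
proof (induction rule: gchain.induct)
  case (step e s t y c)
  then show ?case using gchain.step[of e G s "\<lambda>_. L" t z "c + d"] by (simp add: add.assoc)
qed simp

lemma chain_step:
  "\<lbrakk>f \<in> edges G; s \<in> {0..L}; t \<in> {0..L}\<rbrakk> \<Longrightarrow> chain (pos f s) (pos f t) \<bar>s - t\<bar>"
  using gchain.step[of f G s "\<lambda>_. L" t "pos f t" 0] gchain.refl[OF pos_in_pts[of f t]]
  by simp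

lemma chain_sym: "chain x y c \<Longrightarrow> chain y x c"
proof (induction rule: gchain.induct)
  case (step e s t z c)
  then show ?case
    using chain_trans[OF step.IH chain_step[of e t s]] by (simp add: abs_minus_commute add.commute)
qed (rule gchain.refl)

text \<open>The metric is an infimum, so a lower bound has to control every chain at once. A
  function that is 1-Lipschitz along each edge does so, because its increments telescope. All lower
  bounds on \<open>gd\<close> come from such functions.\<close>

lemma chain_lipschitz:
  assumes "\<And>f s t. \<lbrakk>f \<in> edges G; s \<in> {0..L}; t \<in> {0..L}\<rbrakk> \<Longrightarrow> \<bar>F (pos f s) - F (pos f t)\<bar> \<le> \<bar>s - t\<bar>"
  shows "chain x y c \<Longrightarrow> \<bar>F x - F y\<bar> \<le> c"
proof (induction rule: gchain.induct)
  case (step e s t z c)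
  then show ?case using assms[of e s t] by (simp add: abs_if split: if_splits)
qed simp

lemma gd_lipschitz:
  assumes "\<And>f s t. \<lbrakk>f \<in> edges G; s \<in> {0..L}; t \<in> {0..L}\<rbrakk> \<Longrightarrow> \<bar>F (pos f s) - F (pos f t)\<bar> \<le> \<bar>s - t\<bar>"
  shows "ereal \<bar>F x - F y\<bar> \<le> gd x y"
  unfolding gdist_def using chain_lipschitz[of F x y, OF assms] by (auto intro!: Inf_greatest)

lemma gd_nonneg: "0 \<le> gd x y"
  using gd_lipschitz[of "\<lambda>_. 0" x y] by (simp add: zero_ereal_def)

lemma gd_le_chain: "chain x y c \<Longrightarrow> gd x y \<le> ereal c"
  unfolding gdist_def by (auto intro!: Inf_lower)

lemma gd_less_iff: "gd x y < e \<longleftrightarrow> (\<exists>c. chain x y c \<and> ereal c < e)"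
  unfolding gdist_def Inf_less_iff by auto

lemma gd_refl: "x \<in> pts \<Longrightarrow> gd x x = 0"
  using gd_le_chain[OF gchain.refl] gd_nonneg[of x x] by (metis antisym zero_ereal_def)

lemma gd_sym: "gd x y = gd y x"
  unfolding gdist_def using chain_sym by metis

lemma gd_le_step: "\<lbrakk>f \<in> edges G; s \<in> {0..L}; t \<in> {0..L}\<rbrakk> \<Longrightarrow> gd (pos f s) (pos f t) \<le> ereal \<bar>s - t\<bar>"
  by (intro gd_le_chain chain_step)

lemma gd_triangle: "gd x z \<le> gd x y + gd y z"
proof (cases "gd x y = \<infinity> \<or> gd y z = \<infinity>")
  case True
  then show ?thesis using gd_nonneg[of x y] gd_nonneg[of y z] by auto
next
  case False
  then obtain u v where u: "gd x y = ereal u" and v: "gd y z = ereal v"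
    using gd_nonneg[of x y] gd_nonneg[of y z] by (metis ereal_cases zero_ereal_def MInfty_neq_ereal(2) ereal_less_eq(2) less_eq_ereal_def ereal_infty_less_eq2(2) infinity_ereal_def PInfty_neq_ereal)
  show ?thesis
  proof (rule ereal_le_epsilon2)
    fix e :: real assume "e > 0"
    have "gd x y < ereal (u + e/2)" "gd y z < ereal (v + e/2)" using u v \<open>e > 0\<close> by auto
    then obtain c d where "chain x y c" "c < u + e/2" "chain y z d" "d < v + e/2"
      unfolding gd_less_iff by auto
    then have "gd x z \<le> ereal (c + d)" "c + d \<le> u + v + e" by (auto intro: gd_le_chain chain_trans)
    then show "gd x z \<le> gd x y + gd y z + ereal e" using u v
      by (metis (no_types, lifting) ereal_less_eq(3) order_trans plus_ereal.simps(1))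
  qed
qed

subsection \<open>Stars of points\<close>

text \<open>A germ \<open>(f, t, \<sigma>)\<close> at a point is a direction in which one can leave it: along the edge \<open>f\<close>
  from position \<open>t\<close> with sign \<open>\<sigma>\<close>.\<close>

definition germ_pt :: "'e \<times> real \<times> real \<Rightarrow> real \<Rightarrow> ('v, 'e) gpt" where
  "germ_pt = (\<lambda>(f, t, \<sigma>) \<rho>. pos f (t + \<sigma> * \<rho>))"

definition germs :: "('v, 'e) gpt \<Rightarrow> real \<Rightarrow> ('e \<times> real \<times> real) set" where
  "germs x r = {(f, t, \<sigma>). f \<in> edges G \<and> \<sigma> \<in> {1, -1} \<and> t \<in> {0..L} \<and> t + \<sigma> * r \<in> {0..L} \<and> pos f t = x}"

text \<open>Chosen so that twice the radius still fits: at a vertex it is half an edge, so the two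
  ends of a loop do not overlap; at an interior point it does not pass the end of the edge. The
  tents on the star need this room to return to 0.\<close>

definition star_radius :: "('v, 'e) gpt \<Rightarrow> real" where
  "star_radius x = (case x of Vert v \<Rightarrow> L / 4 | EdgePt f t \<Rightarrow> min t (L - t) / 2)"

abbreviation star_germs where "star_germs x \<equiv> germs x (star_radius x)"

lemma star_radius_pos: "x \<in> pts \<Longrightarrow> star_radius x > 0"
  using L_pos by (auto simp: star_radius_def gpoints_def)

lemma pos_eq_EdgePt: "t \<in> {0..L} \<Longrightarrow> pos f t = EdgePt g s \<longleftrightarrow> f = g \<and> t = s \<and> 0 < t \<and> t < L"
  by (auto simp: gpos_def)

lemma pos_eq_Vert:
  "t \<in> {0..L} \<Longrightarrow> pos f t = Vert v \<longleftrightarrow> (t = 0 \<and> src G f = v) \<or> (t = L \<and> tgt G f = v)"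
  using L_pos by (auto simp: gpos_def)

lemma finite_star_germs: "finite (star_germs x)"
proof (cases x)
  case (Vert v)
  have "star_germs x \<subseteq> edges G \<times> {0, L} \<times> {1, -1}"
    using Vert pos_eq_Vert by (auto simp: germs_def)
  then show ?thesis by (rule finite_subset) (simp add: finite_edges)
next
  case (EdgePt f t)
  have "star_germs x \<subseteq> edges G \<times> {t} \<times> {1, -1}"
    using EdgePt pos_eq_EdgePt by (auto simp: germs_def)
  then show ?thesis by (rule finite_subset) (simp add: finite_edges)
qed

lemma germ_pt_0: "\<beta> \<in> germs x r \<Longrightarrow> germ_pt \<beta> 0 = x"
  by (auto simp: germ_pt_def germs_def)

lemma germ_range:
  "\<lbrakk>(f, t, \<sigma>) \<in> germs x r; 0 \<le> \<rho>; \<rho> \<le> r\<rbrakk> \<Longrightarrow> t + \<sigma> * \<rho> \<in> {0..L}"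
  by (auto simp: germs_def)

lemma exists_germ:
  assumes "f \<in> edges G" "t \<in> {0..L}" "s \<in> {0..L}" "\<bar>s - t\<bar> < star_radius (pos f t)"
  shows "\<exists>\<sigma>. (f, t, \<sigma>) \<in> star_germs (pos f t) \<and> s = t + \<sigma> * \<bar>s - t\<bar>"
proof -
  \<comment> \<open>If \<open>s = t\<close> the sign is arbitrary inside the edge, but at an
    endpoint it must point inwards for the germ to exist.\<close>
  define \<sigma> :: real where "\<sigma> = (if t = 0 then 1 else if t = L then -1 else if s \<ge> t then 1 else -1)"
  have "t + \<sigma> * star_radius (pos f t) \<in> {0..L}"
    using assms(2) L_pos by (auto simp: \<sigma>_def star_radius_def pos_interior min_def field_simps)
  moreover have "s = t + \<sigma> * \<bar>s - t\<bar>" using assms(2,3) by (auto simp: \<sigma>_def)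
  ultimately show ?thesis using assms by (intro exI[of _ \<sigma>]) (auto simp: germs_def \<sigma>_def)
qed

section \<open>Test functions and lower bounds for distances in a star\<close>

definition test_fun :: "('e \<Rightarrow> real \<Rightarrow> real) \<Rightarrow> ('v \<Rightarrow> real) \<Rightarrow> ('v, 'e) gpt \<Rightarrow> real" where
  "test_fun \<phi> \<psi> x = (case x of Vert v \<Rightarrow> \<psi> v | EdgePt f t \<Rightarrow> \<phi> f t)"

lemma test_fun_pos:
  assumes "t \<in> {0..L}" "\<phi> f 0 = \<psi> (src G f)" "\<phi> f L = \<psi> (tgt G f)"
  shows "test_fun \<phi> \<psi> (pos f t) = \<phi> f t"
  using assms by (auto simp: test_fun_def gpos_def)

lemma gd_test_fun:
  assumes "\<And>f. f \<in> edges G \<Longrightarrow> \<phi> f 0 = \<psi> (src G f)" "\<And>f. f \<in> edges G \<Longrightarrow> \<phi> f L = \<psi> (tgt G f)"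
    and "\<And>f s t. \<lbrakk>f \<in> edges G; s \<in> {0..L}; t \<in> {0..L}\<rbrakk> \<Longrightarrow> \<bar>\<phi> f s - \<phi> f t\<bar> \<le> \<bar>s - t\<bar>"
  shows "ereal \<bar>test_fun \<phi> \<psi> x - test_fun \<phi> \<psi> y\<bar> \<le> gd x y"
  by (intro gd_lipschitz) (simp add: assms test_fun_pos)

text \<open>The test function \<open>F\<close> is the radial distance from \<open>x\<close>, cut off
  at the star radius outside the star. It vanishes at \<open>x\<close>, so a point closer than the
  radius has \<open>F\<close> below the cut-off and must lie on a branch. At a vertex the minimum
  over both ends of an edge takes care of loops.\<close>

lemma near_star:
  assumes "x \<in> pts" "y \<in> pts" "gd y x < ereal (star_radius x)"
  shows "y = x \<or> (\<exists>\<beta>\<in>star_germs x. \<exists>\<rho>. 0 \<le> \<rho> \<and> \<rho> < star_radius x \<and> y = germ_pt \<beta> \<rho>)"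
proof (cases x)
  case (Vert v)
  define F where "F = test_fun (\<lambda>f t. min (L/4) (min (if src G f = v then t else L/4) (if tgt G f = v then L - t else L/4)))
    (\<lambda>w. if w = v then 0 else L/4)"
  have "ereal \<bar>F y - F x\<bar> \<le> gd y x"
    unfolding F_def by (rule gd_test_fun) (use L_pos in \<open>auto intro!: abs_min_diff_le\<close>)
  moreover have "F x = 0" by (simp add: F_def test_fun_def Vert)
  ultimately have Fy: "F y < L/4" using assms(3) Vert ereal_between_less[of "\<bar>F y - F x\<bar>" "gd y x" "L/4"]
    by (simp add: star_radius_def)
  show ?thesis
  proof (cases y)
    case (Vert w)
    then show ?thesis using Fy \<open>x = Vert v\<close> by (auto simp: F_def test_fun_def split: if_splits)
  next
    case (EdgePt f t)
    then have t: "f \<in> edges G" "0 < t" "t < L" using assms(2) by (auto simp: gpoints_def)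
    have "(src G f = v \<and> t < L/4) \<or> (tgt G f = v \<and> L - t < L/4)"
      using Fy EdgePt by (auto simp: F_def test_fun_def min_def split: if_splits)
    then show ?thesis
    proof
      assume *: "src G f = v \<and> t < L/4"
      then have "(f, 0, 1) \<in> star_germs x" "y = germ_pt (f, 0, 1) t"
        using t EdgePt Vert L_pos by (auto simp: germs_def star_radius_def germ_pt_def pos_interior)
      moreover have "0 \<le> t" "t < star_radius x" using * t Vert by (auto simp: star_radius_def)
      ultimately show ?thesis by blast
    next
      assume *: "tgt G f = v \<and> L - t < L/4"
      then have "(f, L, -1) \<in> star_germs x" "y = germ_pt (f, L, -1) (L - t)"
        using t EdgePt Vert L_pos by (auto simp: germs_def star_radius_def germ_pt_def pos_interior)
      moreover have "0 \<le> L - t" "L - t < star_radius x" using * t Vert by (auto simp: star_radius_def)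
      ultimately show ?thesis by blast
    qed
  qed
next
  case (EdgePt g b)
  then have b: "g \<in> edges G" "0 < b" "b < L" using assms(1) by (auto simp: gpoints_def)
  define r where "r = star_radius x"
  have r: "0 < r" "2 * r \<le> b" "2 * r \<le> L - b" using b by (auto simp: r_def star_radius_def EdgePt)
  define F where "F = test_fun (\<lambda>f t. if f = g then min r \<bar>t - b\<bar> else r) (\<lambda>w. r)"
  have "ereal \<bar>F y - F x\<bar> \<le> gd y x"
    unfolding F_def by (rule gd_test_fun) (use b r in \<open>auto intro!: abs_min_diff_le\<close>)
  moreover have "F x = 0" using b r by (simp add: F_def test_fun_def EdgePt)
  ultimately have Fy: "F y < r" using assms(3) ereal_between_less[of "\<bar>F y - F x\<bar>" "gd y x" r]
    by (simp add: r_def)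
  then obtain t where t: "y = EdgePt g t" "\<bar>t - b\<bar> < r"
    by (auto simp: F_def test_fun_def split: gpt.splits if_splits)
  have "0 < t" "t < L" using t r by auto
  then have "y = pos g t" "t \<in> {0..L}" by (auto simp: t pos_interior)
  moreover have "x = pos g b" using b EdgePt by (simp add: pos_interior)
  ultimately obtain \<sigma> where "(g, b, \<sigma>) \<in> star_germs x" "t = b + \<sigma> * \<bar>t - b\<bar>"
    using exists_germ[of g b t] t b by (auto simp: r_def)
  then show ?thesis using t \<open>y = pos g t\<close> by (intro disjI2 bexI[of _ "(g, b, \<sigma>)"] exI[of _ "\<bar>t - b\<bar>"]) (auto simp: germ_pt_def r_def)
qed

text \<open>The test functions are tents on the half-star of each germ: positive on one germ,
  negative on the others, and returning to \<open>0\<close> at twice the star radius.\<close>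

lemma gd_germ_pts_tent:
  assumes x: "x \<in> pts" and c: "\<And>\<beta>. \<bar>c \<beta>\<bar> \<le> 1"
    and "\<beta> \<in> star_germs x" "\<beta>' \<in> star_germs x"
    and "\<rho> \<in> {0..star_radius x}" "\<rho>' \<in> {0..star_radius x}"
  shows "ereal \<bar>c \<beta> * \<rho> - c \<beta>' * \<rho>'\<bar> \<le> gd (germ_pt \<beta> \<rho>) (germ_pt \<beta>' \<rho>')"
proof (cases x)
  case (Vert v)
  define tent where "tent t = max 0 (min t (L/2 - t))" for t
  define a where "a f = (if src G f = v then c (f, 0, 1) else 0)" for f
  define b where "b f = (if tgt G f = v then c (f, L, -1) else 0)" for f
  have ab: "\<bar>a f\<bar> \<le> 1" "\<bar>b f\<bar> \<le> 1" for f using c by (auto simp: a_def b_def)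
  have tent: "\<bar>k * tent s - k * tent t\<bar> \<le> \<bar>s - t\<bar>" if "\<bar>k\<bar> \<le> 1" for k s t
    using tent_lipschitz[OF that] by (simp add: tent_def)
  \<comment> \<open>The edge is split at its midpoint, since a loop carries two germs with
    independent coefficients. Both tents vanish there, so a pair of points on different sides is
    compared through this common zero.\<close>
  define \<phi> where "\<phi> f t = (if t \<le> L/2 then a f * tent t else b f * tent (L - t))" for f t
  define F where "F = test_fun \<phi> (\<lambda>_. 0)"
  have mid: "tent (L/2) = 0" using L_pos by (simp add: tent_def)
  have lip: "\<bar>\<phi> f s - \<phi> f t\<bar> \<le> \<bar>s - t\<bar>" for f s t
  proof -
    have *: "\<bar>\<phi> f s - \<phi> f t\<bar> \<le> \<bar>s - t\<bar>" if "s \<le> t" for s t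
      using tent[OF ab(1), of f s t] tent[OF ab(2), of f "L - s" "L - t"]
        tent[OF ab(1), of f s "L/2"] tent[OF ab(2), of f "L/2" "L - t"] that mid
      by (auto simp: \<phi>_def)
    show ?thesis using *[of s t] *[of t s] by (cases "s \<le> t") auto
  qed
  have end0: "\<phi> f 0 = 0" "\<phi> f L = 0" for f using L_pos by (auto simp: \<phi>_def tent_def)
  have F: "ereal \<bar>F y - F z\<bar> \<le> gd y z" for y z
    unfolding F_def by (rule gd_test_fun) (auto simp: lip end0)
  have val: "F (germ_pt \<gamma> \<rho>) = c \<gamma> * \<rho>" if g: "\<gamma> \<in> star_germs x" and \<rho>: "\<rho> \<in> {0..star_radius x}" for \<gamma> \<rho>
  proof -
    obtain f t \<sigma> where [simp]: "\<gamma> = (f, t, \<sigma>)" by (cases \<gamma>)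
    have rng: "t + \<sigma> * \<rho> \<in> {0..L}" using germ_range g \<rho> by auto
    have "(t = 0 \<and> \<sigma> = 1 \<and> src G f = v) \<or> (t = L \<and> \<sigma> = -1 \<and> tgt G f = v)"
      using g L_pos pos_eq_Vert[of t f v] by (auto simp: germs_def Vert star_radius_def)
    then have "\<phi> f (t + \<sigma> * \<rho>) = c \<gamma> * \<rho>"
      using \<rho> L_pos Vert by (auto simp: \<phi>_def a_def b_def tent_def star_radius_def)
    then show ?thesis using rng end0 by (simp add: germ_pt_def F_def test_fun_pos)
  qed
  show ?thesis using F[of "germ_pt \<beta> \<rho>" "germ_pt \<beta>' \<rho>'"] val assms by simp
next
  case (EdgePt g b)
  then have b: "g \<in> edges G" "0 < b" "b < L" using x by (auto simp: gpoints_def)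
  define r where "r = star_radius x"
  have r: "0 < r" "2 * r \<le> b" "2 * r \<le> L - b" using b by (auto simp: r_def star_radius_def EdgePt)
  define tent where "tent t = max 0 (min t (2 * r - t))" for t
  have tent: "\<bar>k * tent s - k * tent t\<bar> \<le> \<bar>s - t\<bar>" if "\<bar>k\<bar> \<le> 1" for k s t
    using tent_lipschitz[OF that] by (simp add: tent_def)
  define \<phi> where "\<phi> f t = (if f = g then if b \<le> t then c (g, b, 1) * tent (t - b) else c (g, b, -1) * tent (b - t) else 0)" for f t
  define F where "F = test_fun \<phi> (\<lambda>_. 0)"
  have mid: "tent 0 = 0" using r by (simp add: tent_def)
  have lip: "\<bar>\<phi> f s - \<phi> f t\<bar> \<le> \<bar>s - t\<bar>" for f s t
  proof -
    have *: "\<bar>\<phi> f s - \<phi> f t\<bar> \<le> \<bar>s - t\<bar>" if "s \<le> t" for s t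
      using tent[OF c, of "(g, b, 1)" "s - b" "t - b"] tent[OF c, of "(g, b, -1)" "b - s" "b - t"]
        tent[OF c, of "(g, b, 1)" "t - b" 0] tent[OF c, of "(g, b, -1)" "b - s" 0] that mid
      by (auto simp: \<phi>_def)
    show ?thesis using *[of s t] *[of t s] by (cases "s \<le> t") auto
  qed
  have end0: "\<phi> f 0 = 0" "\<phi> f L = 0" for f using b r by (auto simp: \<phi>_def tent_def)
  have F: "ereal \<bar>F y - F z\<bar> \<le> gd y z" for y z
    unfolding F_def by (rule gd_test_fun) (auto simp: lip end0)
  have val: "F (germ_pt \<gamma> \<rho>) = c \<gamma> * \<rho>" if g: "\<gamma> \<in> star_germs x" and \<rho>: "\<rho> \<in> {0..star_radius x}" for \<gamma> \<rho>
  proof -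
    obtain f t \<sigma> where [simp]: "\<gamma> = (f, t, \<sigma>)" by (cases \<gamma>)
    have rng: "t + \<sigma> * \<rho> \<in> {0..L}" using germ_range g \<rho> by auto
    have "f = g \<and> t = b \<and> (\<sigma> = 1 \<or> \<sigma> = -1)"
      using g pos_eq_EdgePt[of t f g b] by (auto simp: germs_def EdgePt)
    then have "\<phi> f (t + \<sigma> * \<rho>) = c \<gamma> * \<rho>"
      using \<rho> by (auto simp: \<phi>_def tent_def simp flip: r_def)
    then show ?thesis using rng end0 by (simp add: germ_pt_def F_def test_fun_pos)
  qed
  show ?thesis using F[of "germ_pt \<beta> \<rho>" "germ_pt \<beta>' \<rho>'"] val assms by simp
qed

lemma gd_germ_pts_same:
  assumes "x \<in> pts" "\<beta> \<in> star_germs x" "\<rho> \<in> {0..star_radius x}" "\<rho>' \<in> {0..star_radius x}"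
  shows "ereal \<bar>\<rho> - \<rho>'\<bar> \<le> gd (germ_pt \<beta> \<rho>) (germ_pt \<beta> \<rho>')"
  using gd_germ_pts_tent[of x "\<lambda>_. 1" \<beta> \<beta> \<rho> \<rho>'] assms by simp

text \<open>Opposite signs turn the difference of test values into the sum of the radii. Together
  with the bound on a single branch this says that distances in a star are at least those in a wedge
  of segments.\<close>

lemma gd_germ_pts_diff:
  assumes "x \<in> pts" "\<beta> \<in> star_germs x" "\<beta>' \<in> star_germs x" "\<beta> \<noteq> \<beta>'"
    "\<rho> \<in> {0..star_radius x}" "\<rho>' \<in> {0..star_radius x}"
  shows "ereal (\<rho> + \<rho>') \<le> gd (germ_pt \<beta> \<rho>) (germ_pt \<beta>' \<rho>')"
  using gd_germ_pts_tent[of x "\<lambda>\<gamma>. if \<gamma> = \<beta> then 1 else -1" \<beta> \<beta>' \<rho> \<rho>'] assms by simp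

lemma gd_germ_pt_centre:
  assumes "x \<in> pts" "\<beta> \<in> star_germs x" "\<rho> \<in> {0..star_radius x}"
  shows "ereal \<rho> \<le> gd (germ_pt \<beta> \<rho>) x"
  using gd_germ_pts_same[OF assms, of 0] star_radius_pos[OF assms(1)] assms germ_pt_0[of \<beta> x "star_radius x"] by auto

text \<open>Only a local bound can hold, since a loop brings its two ends together. The radius
  depends on \<open>t\<close>, and distances are compared with the centre \<open>t\<close>
  only.\<close>

lemma gd_pos_near:
  assumes "f \<in> edges G" "t \<in> {0..L}"
  shows "\<exists>r>0. \<forall>s\<in>{0..L}. \<bar>s - t\<bar> < r \<longrightarrow> ereal \<bar>s - t\<bar> \<le> gd (pos f s) (pos f t)"
proof (intro exI conjI ballI impI)
  have x: "pos f t \<in> pts" by (rule pos_in_pts[OF assms(1)])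
  then show "star_radius (pos f t) > 0" by (rule star_radius_pos)
  fix s assume s: "s \<in> {0..L}" "\<bar>s - t\<bar> < star_radius (pos f t)"
  obtain \<sigma> where "(f, t, \<sigma>) \<in> star_germs (pos f t)" "s = t + \<sigma> * \<bar>s - t\<bar>"
    using exists_germ[OF assms s] by auto
  then show "ereal \<bar>s - t\<bar> \<le> gd (pos f s) (pos f t)"
    using gd_germ_pt_centre[OF x, of "(f, t, \<sigma>)" "\<bar>s - t\<bar>"] s by (simp add: germ_pt_def)
qed

end

subsection \<open>Arc length\<close>

text \<open>The sum over a partition from \<open>arclen\<close>, with the distance as a parameter,
  so that one partition can be measured by two distances.\<close>

definition variation :: "('a \<Rightarrow> 'a \<Rightarrow> ereal) \<Rightarrow> 'a list \<Rightarrow> ereal" where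
  "variation d ts = sum_list (map (\<lambda>(a, b). d a b) (zip ts (tl ts)))"

lemma variation_simps [simp]:
  "variation d [] = 0" "variation d [a] = 0"
  "variation d (a # b # ts) = d a b + variation d (b # ts)"
  by (simp_all add: variation_def)

lemma variation_append: "variation d (xs @ b # ys) = variation d (xs @ [b]) + variation d (b # ys)"
proof (induction xs)
  case (Cons a xs)
  then show ?case by (cases xs) (simp_all add: add.assoc)
qed simp

lemma variation_mono:
  "(\<And>a b. a \<in> set ts \<Longrightarrow> b \<in> set ts \<Longrightarrow> d a b \<le> d' a b) \<Longrightarrow> variation d ts \<le> variation d' ts"
proof (induction ts)
  case (Cons a ts)
  then show ?case by (cases ts) (auto intro!: add_mono)
qed simp

lemma arclen_variation:
  "arclen G l p = (SUP ts \<in> {ts. sorted ts \<and> set ts \<subseteq> {0..1}}. variation (\<lambda>a b. gdist G l (p a) (p b)) ts)"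
  by (simp add: arclen_def variation_def)

text \<open>The comparison of \<open>d\<close> and \<open>d'\<close> is available only against a
  fixed point \<open>x\<close>, within a radius that is not uniform, so no fixed mesh works.
  Bisection leads to a partition with tags, as in Cousin's lemma: a short interval around
  \<open>x\<close> is cut at \<open>x\<close>, and both pieces are then compared. The triangle
  inequality is used for \<open>d\<close> only.\<close>

lemma refine_variation:
  fixes d d' :: "real \<Rightarrow> real \<Rightarrow> ereal"
  assumes triangle: "\<And>a b c. d a c \<le> d a b + d b c"
    and sym: "\<And>a b. d a b = d b a" "\<And>a b. d' a b = d' b a"
    and loc: "\<And>x. x \<in> {0..1} \<Longrightarrow> \<exists>\<delta>>0. \<forall>y\<in>{0..1}. \<bar>y - x\<bar> < \<delta> \<longrightarrow> d y x \<le> d' y x"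
    and "a \<le> b" "0 \<le> a" "b \<le> 1"
  shows "\<exists>ws. sorted (a # ws @ [b]) \<and> d a b \<le> variation d' (a # ws @ [b])"
proof -
  have "0 \<le> a \<longrightarrow> b \<le> 1 \<longrightarrow> (\<exists>ws. sorted (a # ws @ [b]) \<and> d a b \<le> variation d' (a # ws @ [b]))"
    using \<open>a \<le> b\<close>
  proof (induction rule: Bolzano)
    case (trans a b c)
    show ?case
    proof (intro impI)
      assume "0 \<le> a" "c \<le> 1"
      then obtain ws ws' where
        "sorted (a # ws @ [b])" "d a b \<le> variation d' (a # ws @ [b])"
        "sorted (b # ws' @ [c])" "d b c \<le> variation d' (b # ws' @ [c])"
        using trans by force
      moreover have "variation d' (a # (ws @ b # ws') @ [c]) = variation d' (a # ws @ [b]) + variation d' (b # ws' @ [c])"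
        using variation_append[of d' "a # ws" b "ws' @ [c]"] by simp
      ultimately show "\<exists>ws. sorted (a # ws @ [c]) \<and> d a c \<le> variation d' (a # ws @ [c])"
        using triangle[of a c b] add_mono[of "d a b" _ "d b c"]
        by (intro exI[of _ "ws @ b # ws'"]) (force simp: sorted_append)
    qed
  next
    case (local x)
    show ?case
    proof (cases "x \<in> {0..1}")
      case True
      then obtain \<delta> where \<delta>: "\<delta> > 0" "\<And>y. y \<in> {0..1} \<Longrightarrow> \<bar>y - x\<bar> < \<delta> \<Longrightarrow> d y x \<le> d' y x"
        using loc by blast
      have "\<exists>ws. sorted (a # ws @ [b]) \<and> d a b \<le> variation d' (a # ws @ [b])"
        if "a \<le> x" "x \<le> b" "b - a < \<delta>" "0 \<le> a" "b \<le> 1" for a b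
      proof -
        have "d a b \<le> d a x + d x b" by (rule triangle)
        also have "\<dots> \<le> d' a x + d' x b"
          using \<delta>(2)[of a] \<delta>(2)[of b] sym that by (intro add_mono) auto
        finally show ?thesis using that by (intro exI[of _ "[x]"]) auto
      qed
      then show ?thesis using \<delta>(1) by blast
    next
      case False
      then show ?thesis by (intro exI[of _ 1]) auto
    qed
  qed
  then show ?thesis using assms by blast
qed

lemma SUP_variation_le:
  fixes d d' :: "real \<Rightarrow> real \<Rightarrow> ereal"
  assumes "\<And>a b c. d a c \<le> d a b + d b c"
    and "\<And>a b. d a b = d b a" "\<And>a b. d' a b = d' b a"
    and "\<And>x. x \<in> {0..1} \<Longrightarrow> \<exists>\<delta>>0. \<forall>y\<in>{0..1}. \<bar>y - x\<bar> < \<delta> \<longrightarrow> d y x \<le> d' y x"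
  shows "(SUP ts \<in> {ts. sorted ts \<and> set ts \<subseteq> {0..1}}. variation d ts)
       \<le> (SUP ts \<in> {ts. sorted ts \<and> set ts \<subseteq> {0..1}}. variation d' ts)"
proof (rule SUP_least)
  fix ts :: "real list" assume ts: "ts \<in> {ts. sorted ts \<and> set ts \<subseteq> {0..1}}"
  \<comment> \<open>The common head is the extra invariant that lets the refinement of the first
    interval be glued to that of the rest.\<close>
  have "\<exists>us. sorted us \<and> set us \<subseteq> {0..1} \<and> variation d ts \<le> variation d' us \<and> (ts \<noteq> [] \<longrightarrow> us \<noteq> [] \<and> hd us = hd ts)"
    using ts
  proof (induction ts)
    case Nil
    show ?case by (intro exI[of _ "[]"]) auto
  next
    case (Cons a ts0)
    show ?case
    proof (cases ts0)
      case Nil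
      then show ?thesis using Cons by (intro exI[of _ "[a]"]) auto
    next
      case (Cons b ts)
      obtain us0 where us0: "sorted us0" "set us0 \<subseteq> {0..1}" "variation d (b # ts) \<le> variation d' us0"
        "us0 \<noteq> []" "hd us0 = b" using Cons.IH Cons.prems Cons by auto
      then obtain us where us: "us0 = b # us" by (cases us0) auto
      have ab: "a \<le> b" "0 \<le> a" "b \<le> 1" using Cons.prems Cons by auto
      obtain ws where ws: "sorted (a # ws @ [b])" "d a b \<le> variation d' (a # ws @ [b])"
        using refine_variation[of d d' a b] assms ab by auto
      have "\<forall>x\<in>set ws. a \<le> x \<and> x \<le> b" using ws(1) by (auto simp: sorted_append)
      then have "set (a # ws @ b # us) \<subseteq> {0..1}" using us0(2) us ab by (auto intro: order_trans)
      moreover have "sorted (a # ws @ b # us)"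
        using ws(1) us0(1) us by (auto simp: sorted_append intro: order_trans)
      moreover have "variation d (a # b # ts) \<le> variation d' (a # ws @ b # us)"
        using ws(2) us0(3) us variation_append[of d' "a # ws" b us] by (auto intro: add_mono)
      ultimately show ?thesis using Cons by (intro exI[of _ "a # ws @ b # us"]) auto
    qed
  qed
  then obtain us where "sorted us" "set us \<subseteq> {0..1}" "variation d ts \<le> variation d' us" by blast
  then show "variation d ts \<le> (SUP ts \<in> {ts. sorted ts \<and> set ts \<subseteq> {0..1}}. variation d' ts)"
    by (auto intro: SUP_upper2)
qed

subsection \<open>Unit speed paths and trails\<close>

context equilateral_graph
begin

text \<open>The lower bound compares only with the centre \<open>t\<close>, not two points near
  \<open>t\<close> with each other. A path may therefore turn back at \<open>t\<close>, which is the
  folding that a covering has to permit, and its arc length is still that of the time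
  interval.\<close>

definition unit_speed :: "(real \<Rightarrow> ('v, 'e) gpt) \<Rightarrow> real \<Rightarrow> bool" where
  "unit_speed g c \<longleftrightarrow> g ` {0..c} \<subseteq> pts \<and>
    (\<forall>s\<in>{0..c}. \<forall>t\<in>{0..c}. gd (g s) (g t) \<le> ereal \<bar>s - t\<bar>) \<and>
    (\<forall>t\<in>{0..c}. \<exists>r>0. \<forall>s\<in>{0..c}. \<bar>s - t\<bar> < r \<longrightarrow> ereal \<bar>s - t\<bar> \<le> gd (g s) (g t))"

definition reach :: "('v, 'e) gpt \<Rightarrow> ('v, 'e) gpt \<Rightarrow> real \<Rightarrow> ('v, 'e) gpt set \<Rightarrow> bool" where
  "reach x y c S \<longleftrightarrow> 0 \<le> c \<and> (\<exists>g. unit_speed g c \<and> g 0 = x \<and> g c = y \<and> S \<subseteq> g ` {0..c})"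

definition seg :: "'e \<Rightarrow> real \<Rightarrow> real \<Rightarrow> ('v, 'e) gpt set" where
  "seg f s t = pos f ` {min s t..max s t}"

fun trail :: "('v, 'e) gpt \<Rightarrow> ('e \<times> real \<times> real) list \<Rightarrow> ('v, 'e) gpt \<Rightarrow> bool" where
  "trail x [] y \<longleftrightarrow> x = y \<and> x \<in> pts"
| "trail x ((f, s, t) # ts) y \<longleftrightarrow>
     f \<in> edges G \<and> s \<in> {0..L} \<and> t \<in> {0..L} \<and> x = pos f s \<and> trail (pos f t) ts y"

definition trail_length :: "('e \<times> real \<times> real) list \<Rightarrow> real" where
  "trail_length ts = sum_list (map (\<lambda>(f, s, t). \<bar>s - t\<bar>) ts)"

text \<open>For a nonempty trail \<open>x\<close> lies on the first segment anyway; inserting it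
  gives the empty trail a trace.\<close>

definition trace :: "('v, 'e) gpt \<Rightarrow> ('e \<times> real \<times> real) list \<Rightarrow> ('v, 'e) gpt set" where
  "trace x ts = insert x (\<Union>(f, s, t)\<in>set ts. seg f s t)"

lemma unit_speed_pts: "unit_speed g c \<Longrightarrow> t \<in> {0..c} \<Longrightarrow> g t \<in> pts"
  by (auto simp: unit_speed_def)

lemma unit_speed_lipschitz:
  "unit_speed g c \<Longrightarrow> s \<in> {0..c} \<Longrightarrow> t \<in> {0..c} \<Longrightarrow> gd (g s) (g t) \<le> ereal \<bar>s - t\<bar>"
  by (simp add: unit_speed_def)

lemma unit_speed_local:
  assumes "unit_speed g c" "t \<in> {0..c}"
  obtains r where "r > 0" "\<And>s. s \<in> {0..c} \<Longrightarrow> \<bar>s - t\<bar> < r \<Longrightarrow> ereal \<bar>s - t\<bar> \<le> gd (g s) (g t)"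
  using assms unfolding unit_speed_def by blast

lemma reach_refl: "x \<in> pts \<Longrightarrow> reach x x 0 {x}"
  unfolding reach_def unit_speed_def
  by (intro conjI exI[of _ "\<lambda>_. x"]) (auto simp: gd_refl zero_ereal_def intro: exI[of _ 1])

lemma reach_trans:
  assumes "reach x y c S" "reach y z d T"
  shows "reach x z (c + d) (S \<union> T)"
proof -
  obtain g where g: "unit_speed g c" "g 0 = x" "g c = y" "S \<subseteq> g ` {0..c}" "0 \<le> c"
    using assms(1) by (auto simp: reach_def)
  obtain h where h: "unit_speed h d" "h 0 = y" "h d = z" "T \<subseteq> h ` {0..d}" "0 \<le> d"
    using assms(2) by (auto simp: reach_def)
  define k where "k u = (if u \<le> c then g u else h (u - c))" for u
  have kh: "k u = h (u - c)" if "u \<ge> c" for u using that g h by (cases "u = c") (auto simp: k_def)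
  have kg: "k u = g u" if "u \<le> c" for u using that by (simp add: k_def)
  have gl: "gd (g s) (g t) \<le> ereal \<bar>s - t\<bar>" if "s \<in> {0..c}" "t \<in> {0..c}" for s t
    using g that by (auto simp: unit_speed_def)
  have hl: "gd (h s) (h t) \<le> ereal \<bar>s - t\<bar>" if "s \<in> {0..d}" "t \<in> {0..d}" for s t
    using h that by (auto simp: unit_speed_def)
  have lip_le: "gd (k s) (k t) \<le> ereal \<bar>s - t\<bar>" if "s \<le> t" "s \<in> {0..c+d}" "t \<in> {0..c+d}" for s t
  proof -
    consider "t \<le> c" | "c \<le> s" | "s \<le> c" "c \<le> t" by linarith
    then show ?thesis
    proof cases
      case 1 then show ?thesis using gl[of s t] that by (simp add: kg)
    next
      case 2 then show ?thesis using hl[of "s - c" "t - c"] that by (simp add: kh)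
    next
      case 3
      have "gd (k s) (k t) \<le> gd (k s) (k c) + gd (k c) (k t)" by (rule gd_triangle)
      also have "\<dots> \<le> ereal \<bar>s - c\<bar> + ereal \<bar>c - t\<bar>"
        using gl[of s c] hl[of 0 "t - c"] that 3 g(5) h(2) g(3) by (intro add_mono) (auto simp: kg kh)
      finally show ?thesis using 3 by simp
    qed
  qed
  have lip: "gd (k s) (k t) \<le> ereal \<bar>s - t\<bar>" if "s \<in> {0..c+d}" "t \<in> {0..c+d}" for s t
    using lip_le[of s t] lip_le[of t s] that gd_sym by (cases "s \<le> t") (auto simp: abs_minus_commute)
  \<comment> \<open>The two halves are treated separately, each with its own radius; if
    \<open>t\<close> lies outside a half, its distance to that half makes the condition vacuous. At
    the junction nothing relates points on opposite sides, so a fold there is harmless.\<close>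
  have loc: "\<exists>r>0. \<forall>s\<in>{0..c+d}. \<bar>s - t\<bar> < r \<longrightarrow> ereal \<bar>s - t\<bar> \<le> gd (k s) (k t)" if t: "t \<in> {0..c+d}" for t
  proof -
    have "\<exists>r>0. \<forall>s\<in>{0..c}. \<bar>s - t\<bar> < r \<longrightarrow> ereal \<bar>s - t\<bar> \<le> gd (k s) (k t)"
    proof (cases "t \<le> c")
      case True
      then obtain r where "r > 0" "\<And>s. s \<in> {0..c} \<Longrightarrow> \<bar>s - t\<bar> < r \<Longrightarrow> ereal \<bar>s - t\<bar> \<le> gd (g s) (g t)"
        using unit_speed_local[OF g(1), of t] t by auto
      then show ?thesis using True by (intro exI[of _ r]) (auto simp: kg)
    next
      case False
      then show ?thesis by (intro exI[of _ "t - c"]) auto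
    qed
    then obtain r1 where r1: "r1 > 0" "\<And>s. s \<in> {0..c} \<Longrightarrow> \<bar>s - t\<bar> < r1 \<Longrightarrow> ereal \<bar>s - t\<bar> \<le> gd (k s) (k t)" by blast
    have "\<exists>r>0. \<forall>s\<in>{c..c+d}. \<bar>s - t\<bar> < r \<longrightarrow> ereal \<bar>s - t\<bar> \<le> gd (k s) (k t)"
    proof (cases "t \<ge> c")
      case True
      then obtain r where r: "r > 0" "\<And>s. s \<in> {0..d} \<Longrightarrow> \<bar>s - (t - c)\<bar> < r \<Longrightarrow> ereal \<bar>s - (t - c)\<bar> \<le> gd (h s) (h (t - c))"
        using unit_speed_local[OF h(1), of "t - c"] t True by auto
      show ?thesis
      proof (intro exI conjI ballI impI)
        fix s assume "s \<in> {c..c+d}" "\<bar>s - t\<bar> < r"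
        then show "ereal \<bar>s - t\<bar> \<le> gd (k s) (k t)" using r(2)[of "s - c"] True by (simp add: kh)
      qed (rule r(1))
    next
      case False
      then show ?thesis by (intro exI[of _ "c - t"]) auto
    qed
    then obtain r2 where r2: "r2 > 0" "\<And>s. s \<in> {c..c+d} \<Longrightarrow> \<bar>s - t\<bar> < r2 \<Longrightarrow> ereal \<bar>s - t\<bar> \<le> gd (k s) (k t)" by blast
    show ?thesis
    proof (intro exI[of _ "min r1 r2"] conjI ballI impI)
      fix s assume "s \<in> {0..c+d}" "\<bar>s - t\<bar> < min r1 r2"
      then show "ereal \<bar>s - t\<bar> \<le> gd (k s) (k t)" using r1(2)[of s] r2(2)[of s] by (cases "s \<le> c") auto
    qed (use r1 r2 in auto)
  qed
  have img: "k ` {0..c+d} = g ` {0..c} \<union> h ` {0..d}"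
  proof -
    have "{0..c+d} = {0..c} \<union> (+) c ` {0..d}" using g(5) h(5) by auto
    then have "k ` {0..c+d} = k ` {0..c} \<union> (\<lambda>u. k (c + u)) ` {0..d}" by (simp only: image_Un image_image)
    also have "k ` {0..c} = g ` {0..c}" by (intro image_cong) (auto simp: kg)
    also have "(\<lambda>u. k (c + u)) ` {0..d} = h ` {0..d}" by (intro image_cong) (auto simp: kh)
    finally show ?thesis .
  qed
  have "unit_speed k (c + d)"
    unfolding unit_speed_def using lip loc img g(1) h(1) by (auto simp: unit_speed_def)
  moreover have "k 0 = x" "k (c + d) = z" using g h by (auto simp: kg kh)
  ultimately show ?thesis
    using img g h unfolding reach_def by (intro conjI exI[of _ k]) auto
qed

lemma reach_seg:
  assumes f: "f \<in> edges G" and st: "s \<in> {0..L}" "t \<in> {0..L}"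
  shows "reach (pos f s) (pos f t) \<bar>s - t\<bar> (seg f s t)"
proof -
  define \<sigma> :: real where "\<sigma> = (if s \<le> t then 1 else -1)"
  define c where "c = \<bar>s - t\<bar>"
  define k where "k u = s + \<sigma> * u" for u
  have k: "k u \<in> {0..L}" if "u \<in> {0..c}" for u using that st by (auto simp: k_def \<sigma>_def c_def)
  have dk: "\<bar>k u - k v\<bar> = \<bar>u - v\<bar>" for u v by (auto simp: k_def \<sigma>_def)
  have "unit_speed (\<lambda>u. pos f (k u)) c"
    unfolding unit_speed_def
  proof (intro conjI ballI)
    show "(\<lambda>u. pos f (k u)) ` {0..c} \<subseteq> pts" using f pos_in_pts by auto
    fix v assume v: "v \<in> {0..c}"
    show "gd (pos f (k u)) (pos f (k v)) \<le> ereal \<bar>u - v\<bar>" if "u \<in> {0..c}" for u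
      using gd_le_step[OF f k[OF that] k[OF v]] dk by simp
    obtain r where "r > 0" "\<And>u. u \<in> {0..L} \<Longrightarrow> \<bar>u - k v\<bar> < r \<Longrightarrow> ereal \<bar>u - k v\<bar> \<le> gd (pos f u) (pos f (k v))"
      using gd_pos_near[OF f k[OF v]] by blast
    then show "\<exists>r>0. \<forall>u\<in>{0..c}. \<bar>u - v\<bar> < r \<longrightarrow> ereal \<bar>u - v\<bar> \<le> gd (pos f (k u)) (pos f (k v))"
      using k dk by (intro exI[of _ r]) metis
  qed
  moreover have "seg f s t \<subseteq> (\<lambda>u. pos f (k u)) ` {0..c}"
    unfolding seg_def
  proof (rule image_subsetI)
    fix w assume "w \<in> {min s t..max s t}"
    then have "w = k \<bar>w - s\<bar>" "\<bar>w - s\<bar> \<in> {0..c}" by (auto simp: k_def \<sigma>_def c_def)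
    then show "pos f w \<in> (\<lambda>u. pos f (k u)) ` {0..c}" by (metis imageI)
  qed
  moreover have "k 0 = s" "k c = t" by (auto simp: k_def c_def \<sigma>_def)
  ultimately show ?thesis unfolding reach_def c_def[symmetric] by (intro conjI exI[of _ "\<lambda>u. pos f (k u)"]) (auto simp: c_def)
qed

lemma reach_mono: "reach x y c S \<Longrightarrow> T \<subseteq> S \<Longrightarrow> reach x y c T"
  by (auto simp: reach_def)

lemma reach_trail: "trail x ts y \<Longrightarrow> reach x y (trail_length ts) (trace x ts)"
proof (induction x ts y rule: trail.induct)
  case (1 x y)
  then show ?case using reach_refl[of x] by (auto simp: trail_length_def trace_def)
next
  case (2 x f s t ts y)
  then have "reach x y (\<bar>s - t\<bar> + trail_length ts) (seg f s t \<union> trace (pos f t) ts)"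
    using reach_trans[OF reach_seg] by simp
  moreover have "trace x ((f, s, t) # ts) \<subseteq> seg f s t \<union> trace (pos f t) ts"
    using 2(2) by (auto simp: trace_def seg_def)
  ultimately show ?case by (auto simp: trail_length_def intro: reach_mono)
qed

lemma reach_loop:
  assumes f: "f \<in> edges G" and s: "s \<in> {0..L}" and w: "0 \<le> w"
  shows "reach (pos f s) (pos f s) w {}"
proof -
  \<comment> \<open>The duration \<open>w\<close> is divided into \<open>n\<close> round trips of
    reach \<open>w / (2 * n)\<close>. The choice of \<open>n\<close> makes this reach at most
    \<open>L / 2\<close>, so there is room on one side of \<open>s\<close>.\<close>
  obtain n :: nat where n: "w / L < real n" using reals_Archimedean2 by blast
  then have n0: "real n > 0" using w L_pos by (smt (verit) divide_nonneg_pos)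
  define \<delta> where "\<delta> = w / (2 * n)"
  have \<delta>: "0 \<le> \<delta>" "\<delta> \<le> L / 2" using w n n0 L_pos by (auto simp: \<delta>_def field_simps)
  define t where "t = (if s \<le> L / 2 then s + \<delta> else s - \<delta>)"
  have t: "t \<in> {0..L}" "\<bar>s - t\<bar> = \<delta>" using s \<delta> by (auto simp: t_def)
  have "reach (pos f s) (pos f s) (2 * \<delta>) {}"
    using reach_trans[OF reach_seg[OF f s t(1)] reach_seg[OF f t(1) s]] t
    by (auto intro: reach_mono simp: abs_minus_commute)
  then have "reach (pos f s) (pos f s) (real k * (2 * \<delta>)) {}" for k :: nat
  proof (induction k)
    case 0
    then show ?case using reach_mono[OF reach_refl[OF pos_in_pts[OF f]]] by simp
  next
    case (Suc k)
    then show ?case using reach_trans[of _ _ "2 * \<delta>" "{}" _ "real k * (2 * \<delta>)" "{}"] by (simp add: algebra_simps)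
  qed
  from this[of n] show ?thesis using n0 by (simp add: \<delta>_def)
qed

text \<open>A nonempty trail provides an edge at \<open>x\<close> on which the surplus time is spent
  going back and forth. At an isolated vertex there would be no way to spend it.\<close>

lemma reach_trail_padded:
  assumes "trail x ts y" "ts \<noteq> []" "trail_length ts \<le> c"
  shows "reach x y c (trace x ts)"
proof -
  obtain f s where "f \<in> edges G" "s \<in> {0..L}" "x = pos f s"
    using assms by (cases ts) auto
  then have "reach x x (c - trail_length ts) {}" using reach_loop assms(3) by simp
  from reach_trans[OF this reach_trail[OF assms(1)]] show ?thesis by simp
qed

end

subsection \<open>Replacing Lipschitz paths by trails\<close>

text \<open>The coordinates share one unit of speed, so detours through values taken at different
  times do not compete for it. The induction adds the index \<open>j\<close> with the latest time:
  until \<open>u j\<close> the bound for the other indices applies, and afterwards all coordinates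
  together travel at most \<open>e - u j\<close>. The triangle inequality at \<open>u j\<close>
  joins the two.\<close>

lemma l1_excursions:
  fixes b :: "'i \<Rightarrow> real \<Rightarrow> real"
  assumes "finite A" "finite I"
    and lip: "\<And>x y. \<lbrakk>s \<le> x; x \<le> y; y \<le> e\<rbrakk> \<Longrightarrow> (\<Sum>i\<in>I. \<bar>b i x - b i y\<bar>) \<le> y - x"
    and "\<And>i. i \<in> A \<Longrightarrow> u i \<in> {s..e}" "s \<le> e"
  shows "(\<Sum>i\<in>I. if i \<in> A then \<bar>b i s - b i (u i)\<bar> + \<bar>b i (u i) - b i e\<bar> else \<bar>b i s - b i e\<bar>) \<le> e - s"
  using assms(1,3-)
proof (induction arbitrary: e rule: finite_ranking_induct[where f = u])
  case empty
  then show ?case using empty.prems(1)[of s e] by simp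
next
  case (insert j A)
  let ?g = "\<lambda>A e i. if i \<in> A then \<bar>b i s - b i (u i)\<bar> + \<bar>b i (u i) - b i e\<bar> else \<bar>b i s - b i e\<bar>"
  have j: "u j \<in> {s..e}" using insert.prems by auto
  have IH: "(\<Sum>i\<in>I. ?g A (u j) i) \<le> u j - s"
  proof (rule insert.IH)
    show "(\<Sum>i\<in>I. \<bar>b i x - b i y\<bar>) \<le> y - x" if "s \<le> x" "x \<le> y" "y \<le> u j" for x y
      using insert.prems(1)[of x y] that j by simp
  qed (use insert.prems(2) insert.hyps j in auto)
  have "(\<Sum>i\<in>I. ?g (insert j A) e i) \<le> (\<Sum>i\<in>I. ?g A (u j) i + \<bar>b i (u j) - b i e\<bar>)"
    by (rule sum_mono) auto
  also have "\<dots> \<le> (u j - s) + (e - u j)"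
    unfolding sum.distrib using IH insert.prems(1)[of "u j" e] j by (intro add_mono) auto
  finally show ?case by simp
qed

context equilateral_graph
begin

text \<open>The same interface as \<open>reach\<close>, but witnessed by a finite list of moves,
  which can be perturbed afterwards.\<close>

definition trav :: "('v, 'e) gpt \<Rightarrow> ('v, 'e) gpt \<Rightarrow> real \<Rightarrow> ('v, 'e) gpt set \<Rightarrow> bool" where
  "trav x y c S \<longleftrightarrow> (\<exists>ts. trail x ts y \<and> trail_length ts = c \<and> S \<subseteq> trace x ts)"

lemma seg_commute: "seg f s t = seg f t s"
  by (simp add: seg_def min.commute max.commute)

lemma pos_in_seg: "pos f s \<in> seg f s t" "pos f t \<in> seg f s t"
  by (auto simp: seg_def)

lemma trail_end_in_trace: "trail x ts y \<Longrightarrow> y \<in> trace x ts"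
proof (induction x ts y rule: trail.induct)
  case (2 x f s t ts y)
  then show ?case by (auto simp: trace_def seg_def)
qed (simp add: trace_def)

lemma trail_append: "trail x ts y \<Longrightarrow> trail y us z \<Longrightarrow> trail x (ts @ us) z"
  by (induction x ts y rule: trail.induct) auto

lemma trav_refl: "x \<in> pts \<Longrightarrow> trav x x 0 {x}"
  unfolding trav_def by (intro exI[of _ "[]"]) (auto simp: trail_length_def trace_def)

lemma trav_step: "\<lbrakk>f \<in> edges G; s \<in> {0..L}; t \<in> {0..L}\<rbrakk> \<Longrightarrow> trav (pos f s) (pos f t) \<bar>s - t\<bar> (seg f s t)"
  unfolding trav_def by (intro exI[of _ "[(f, s, t)]"]) (auto simp: trail_length_def trace_def pos_in_pts)

lemma trav_trans: "trav x y c S \<Longrightarrow> trav y z d T \<Longrightarrow> trav x z (c + d) (S \<union> T)"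
proof -
  assume "trav x y c S" "trav y z d T"
  then obtain ts us where ts: "trail x ts y" "trail_length ts = c" "S \<subseteq> trace x ts"
    and us: "trail y us z" "trail_length us = d" "T \<subseteq> trace y us"
    by (auto simp: trav_def)
  have "trace x ts \<union> trace y us \<subseteq> trace x (ts @ us)"
    using trail_end_in_trace[OF ts(1)] by (auto simp: trace_def)
  then show ?thesis
    unfolding trav_def using ts us trail_append[OF ts(1) us(1)]
    by (intro exI[of _ "ts @ us"]) (auto simp: trail_length_def)
qed

lemma trav_mono: "trav x y c S \<Longrightarrow> T \<subseteq> S \<Longrightarrow> trav x y c T"
  by (auto simp: trav_def)

lemma trav_sym: "trav x y c S \<Longrightarrow> trav y x c S"
proof -
  have "trail x ts y \<Longrightarrow> trav y x (trail_length ts) (trace x ts)" for ts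
  proof (induction x ts y rule: trail.induct)
    case (1 x y)
    then show ?case using trav_refl[of x] by (auto simp: trail_length_def trace_def)
  next
    case (2 x f s t ts y)
    then have "trav y x (trail_length ts + \<bar>t - s\<bar>) (trace (pos f t) ts \<union> seg f t s)"
      using trav_trans[OF _ trav_step[of f t s]] by simp
    moreover have "trace x ((f, s, t) # ts) \<subseteq> trace (pos f t) ts \<union> seg f t s"
      using 2(2) pos_in_seg[of f s t] by (auto simp: trace_def seg_commute[of f t s])
    ultimately show ?case
      by (auto simp: trail_length_def abs_minus_commute add.commute intro: trav_mono)
  qed
  then show "trav x y c S \<Longrightarrow> trav y x c S"
    by (auto simp: trav_def[of x] intro: trav_mono)
qed

lemma trav_germ:
  assumes "\<beta> \<in> germs x r" "\<rho> \<in> {0..r}" "\<rho>' \<in> {0..r}"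
  shows "trav (germ_pt \<beta> \<rho>) (germ_pt \<beta> \<rho>') \<bar>\<rho> - \<rho>'\<bar> (germ_pt \<beta> ` {min \<rho> \<rho>'..max \<rho> \<rho>'})"
proof -
  obtain f t \<sigma> where [simp]: "\<beta> = (f, t, \<sigma>)" by (cases \<beta>)
  have f: "f \<in> edges G" and \<sigma>: "\<sigma> = 1 \<or> \<sigma> = -1" using assms(1) by (auto simp: germs_def)
  have rng: "t + \<sigma> * \<rho> \<in> {0..L}" "t + \<sigma> * \<rho>' \<in> {0..L}" using germ_range assms by auto
  have "trav (germ_pt \<beta> \<rho>) (germ_pt \<beta> \<rho>') \<bar>(t + \<sigma> * \<rho>) - (t + \<sigma> * \<rho>')\<bar> (seg f (t + \<sigma> * \<rho>) (t + \<sigma> * \<rho>'))"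
    using trav_step[OF f rng] by (simp add: germ_pt_def)
  moreover have "germ_pt \<beta> ` {min \<rho> \<rho>'..max \<rho> \<rho>'} \<subseteq> seg f (t + \<sigma> * \<rho>) (t + \<sigma> * \<rho>')"
    unfolding seg_def germ_pt_def using \<sigma> by (auto intro!: imageI simp: min_def max_def)
  moreover have "\<bar>(t + \<sigma> * \<rho>) - (t + \<sigma> * \<rho>')\<bar> = \<bar>\<rho> - \<rho>'\<bar>" using \<sigma> by auto
  ultimately show ?thesis by (auto intro: trav_mono)
qed

text \<open>Near its starting point, a \<open>1\<close>-Lipschitz path is replaced by one that visits the extreme
  point of each branch of the star once; the cost is controlled because excursions into
  different branches take place at different times.\<close>

lemma short_path_trav:
  assumes x0: "x0 \<in> pts" and D: "0 \<le> D" "D < star_radius x0"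
    and pts: "\<And>x. x \<in> {0..D} \<Longrightarrow> \<delta> x \<in> pts"
    and lip: "\<And>x y. x \<in> {0..D} \<Longrightarrow> y \<in> {0..D} \<Longrightarrow> gd (\<delta> x) (\<delta> y) \<le> ereal \<bar>x - y\<bar>"
    and \<delta>0: "\<delta> 0 = x0"
  shows "\<exists>c\<le>D. trav x0 (\<delta> D) c (\<delta> ` {0..D})"
proof -
  define r where "r = star_radius x0"
  define \<Gamma> where "\<Gamma> = star_germs x0"
  have fin: "finite \<Gamma>" by (simp add: \<Gamma>_def finite_star_germs)
  have star: "\<delta> x = x0 \<or> (\<exists>\<beta>\<in>\<Gamma>. \<exists>\<rho>. 0 \<le> \<rho> \<and> \<rho> < r \<and> \<delta> x = germ_pt \<beta> \<rho>)" if "x \<in> {0..D}" for x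
  proof -
    have "gd (\<delta> x) x0 \<le> ereal x" using lip[of x 0] that D \<delta>0 by auto
    also have "\<dots> < ereal (star_radius x0)" using that D by auto
    finally show ?thesis using near_star[OF x0 pts[OF that]] by (auto simp: r_def \<Gamma>_def)
  qed
  show ?thesis
  \<comment> \<open>Without germs, \<open>x0\<close> is an isolated vertex and the path stays
    there.\<close>
  proof (cases "\<Gamma> = {}")
    case True
    then have \<delta>: "\<delta> x = x0" if "x \<in> {0..D}" for x using star[OF that] by simp
    then have "\<delta> ` {0..D} \<subseteq> {x0}" "\<delta> D = x0" using D by auto
    then show ?thesis using trav_mono[OF trav_refl[OF x0]] D by metis
  next
    case False
    have r: "r > 0" using star_radius_pos x0 by (simp add: r_def)
    \<comment> \<open>The centre lies on every branch; it gets an arbitrary germ with radius 0,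
      which leaves the coordinates \<open>b\<close> below unaffected.\<close>
    have "\<exists>\<beta> \<rho>. x \<in> {0..D} \<longrightarrow> \<beta> \<in> \<Gamma> \<and> 0 \<le> \<rho> \<and> \<rho> < r \<and> \<delta> x = germ_pt \<beta> \<rho>" for x
    proof (cases "x \<in> {0..D} \<and> \<delta> x = x0")
      case True
      obtain \<beta> where "\<beta> \<in> \<Gamma>" using False by auto
      then show ?thesis using True r germ_pt_0[of \<beta> x0 "star_radius x0"] by (intro exI[of _ \<beta>] exI[of _ 0]) (auto simp: \<Gamma>_def)
    qed (use star in blast)
    then obtain B P where BP: "\<And>x. x \<in> {0..D} \<Longrightarrow> B x \<in> \<Gamma> \<and> 0 \<le> P x \<and> P x < r \<and> \<delta> x = germ_pt (B x) (P x)"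
      by metis
    \<comment> \<open>These are the coordinates of the path in the star, seen as a wedge of
      segments; at most one of them is nonzero. The two lower bounds for distances in a star say
      that \<open>gd\<close> dominates their l1 distance.\<close>
    define b where "b \<beta> x = (if B x = \<beta> then P x else 0)" for \<beta> x
    have l1: "(\<Sum>\<beta>\<in>\<Gamma>. \<bar>b \<beta> x - b \<beta> y\<bar>) \<le> \<bar>x - y\<bar>" if x: "x \<in> {0..D}" and y: "y \<in> {0..D}" for x y
    proof (cases "B x = B y")
      case True
      have "(\<Sum>\<beta>\<in>\<Gamma>. \<bar>b \<beta> x - b \<beta> y\<bar>) = (\<Sum>\<beta>\<in>\<Gamma>. if \<beta> = B x then \<bar>P x - P y\<bar> else 0)"
        using True by (intro sum.cong) (auto simp: b_def)
      also have "\<dots> = \<bar>P x - P y\<bar>" using fin BP[OF x] by simp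
      finally have eq: "(\<Sum>\<beta>\<in>\<Gamma>. \<bar>b \<beta> x - b \<beta> y\<bar>) = \<bar>P x - P y\<bar>" .
      have "ereal \<bar>P x - P y\<bar> \<le> gd (\<delta> x) (\<delta> y)"
        using gd_germ_pts_same[OF x0, of "B x" "P x" "P y"] BP[OF x] BP[OF y] True by (auto simp: r_def \<Gamma>_def)
      then show ?thesis using lip[OF x y] eq by (metis ereal_less_eq(3) order_trans)
    next
      case False
      have "(\<Sum>\<beta>\<in>\<Gamma>. \<bar>b \<beta> x - b \<beta> y\<bar>) = (\<Sum>\<beta>\<in>\<Gamma>. (if \<beta> = B x then P x else 0) + (if \<beta> = B y then P y else 0))"
        using False BP[OF x] BP[OF y] by (intro sum.cong) (auto simp: b_def)
      also have "\<dots> = P x + P y" using fin BP[OF x] BP[OF y] by (simp add: sum.distrib)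
      finally have eq: "(\<Sum>\<beta>\<in>\<Gamma>. \<bar>b \<beta> x - b \<beta> y\<bar>) = P x + P y" .
      have "ereal (P x + P y) \<le> gd (\<delta> x) (\<delta> y)"
        using gd_germ_pts_diff[OF x0, of "B x" "B y" "P x" "P y"] BP[OF x] BP[OF y] False by (auto simp: r_def \<Gamma>_def)
      then show ?thesis using lip[OF x y] eq by (metis ereal_less_eq(3) order_trans)
    qed
    have "\<exists>u\<in>{0..D}. \<forall>y\<in>{0..D}. b \<beta> y \<le> b \<beta> u" if "\<beta> \<in> \<Gamma>" for \<beta>
    proof (rule continuous_attains_sup)
      have "\<bar>b \<beta> x - b \<beta> y\<bar> \<le> \<bar>x - y\<bar>" if "x \<in> {0..D}" "y \<in> {0..D}" for x y
        using member_le_sum[of \<beta> \<Gamma> "\<lambda>\<beta>. \<bar>b \<beta> x - b \<beta> y\<bar>"] l1[OF that] \<open>\<beta> \<in> \<Gamma>\<close> fin by auto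
      then have "uniformly_continuous_on {0..D} (b \<beta>)"
        unfolding uniformly_continuous_on_def dist_real_def by (meson le_less_trans)
      then show "continuous_on {0..D} (b \<beta>)" by (rule uniformly_continuous_imp_continuous)
    qed (use D in auto)
    then obtain u where u: "\<And>\<beta>. \<beta> \<in> \<Gamma> \<Longrightarrow> u \<beta> \<in> {0..D}" "\<And>\<beta> y. \<beta> \<in> \<Gamma> \<Longrightarrow> y \<in> {0..D} \<Longrightarrow> b \<beta> y \<le> b \<beta> (u \<beta>)"
      by metis
    define \<rho> where "\<rho> \<beta> = b \<beta> (u \<beta>)" for \<beta>
    have \<rho>: "\<rho> \<beta> \<in> {0..r}" if "\<beta> \<in> \<Gamma>" for \<beta>
      using BP[OF u(1)[OF that]] r by (auto simp: \<rho>_def b_def)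
    have P_le: "P x \<le> \<rho> (B x)" if "x \<in> {0..D}" for x
      using u(2)[of "B x" x] BP[OF that] that by (auto simp: b_def \<rho>_def)
    have "P 0 = 0"
    proof -
      have 0: "0 \<in> {0..D}" using D by simp
      have "ereal (P 0) \<le> gd x0 x0"
        using gd_germ_pt_centre[OF x0, of "B 0" "P 0"] BP[OF 0] \<delta>0 by (auto simp: r_def \<Gamma>_def)
      then show ?thesis using gd_refl[OF x0] BP[OF 0] by (simp add: zero_ereal_def)
    qed
    then have b0: "b \<beta> 0 = 0" for \<beta> by (simp add: b_def)
    \<comment> \<open>Going out and back on every branch costs twice its extent, less the last
      stretch from \<open>P D\<close> to the centre. As each coordinate starts at 0, the excursion
      through time \<open>u \<beta>\<close> has variation
      \<open>2 * \<rho> \<beta> - b \<beta> D\<close>, and only the branch \<open>B D\<close> can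
      have a nonzero end value.\<close>
    have total: "(\<Sum>\<beta>\<in>\<Gamma>. 2 * \<rho> \<beta>) - P D \<le> D"
    proof -
      have "(\<Sum>\<beta>\<in>\<Gamma>. 2 * \<rho> \<beta> - b \<beta> D) \<le> (\<Sum>\<beta>\<in>\<Gamma>. if \<beta> \<in> \<Gamma> then \<bar>b \<beta> 0 - b \<beta> (u \<beta>)\<bar> + \<bar>b \<beta> (u \<beta>) - b \<beta> D\<bar> else \<bar>b \<beta> 0 - b \<beta> D\<bar>)"
        by (rule sum_mono) (auto simp: b0 \<rho>_def)
      also have "\<dots> \<le> D - 0"
      proof (rule l1_excursions[OF fin fin])
        fix x y assume "0 \<le> x" "x \<le> y" "y \<le> D"
        then show "(\<Sum>\<beta>\<in>\<Gamma>. \<bar>b \<beta> x - b \<beta> y\<bar>) \<le> y - x" using l1[of x y] by auto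
      qed (use u D in auto)
      also have "(\<Sum>\<beta>\<in>\<Gamma>. 2 * \<rho> \<beta> - b \<beta> D) = (\<Sum>\<beta>\<in>\<Gamma>. 2 * \<rho> \<beta>) - P D"
        using fin BP[of D] D by (simp add: sum_subtractf b_def)
      finally show ?thesis by simp
    qed
    have arm: "trav x0 (germ_pt \<beta> (\<rho> \<beta>)) (\<rho> \<beta>) (germ_pt \<beta> ` {0..\<rho> \<beta>})" if "\<beta> \<in> \<Gamma>" for \<beta>
      using trav_germ[of \<beta> x0 r 0 "\<rho> \<beta>"] \<rho>[OF that] that r germ_pt_0[of \<beta> x0 r] by (auto simp: \<Gamma>_def r_def min_def max_def)
    have arms: "trav x0 x0 (\<Sum>\<beta>\<in>A. 2 * \<rho> \<beta>) (\<Union>\<beta>\<in>A. germ_pt \<beta> ` {0..\<rho> \<beta>})" if "finite A" "A \<subseteq> \<Gamma>" for A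
      using that
    proof (induction A rule: finite_induct)
      case empty
      then show ?case using trav_mono[OF trav_refl[OF x0]] by simp
    next
      case (insert \<beta> A)
      then have "trav x0 x0 (\<Sum>\<beta>\<in>A. 2 * \<rho> \<beta>) (\<Union>\<beta>\<in>A. germ_pt \<beta> ` {0..\<rho> \<beta>})" "trav x0 (germ_pt \<beta> (\<rho> \<beta>)) (\<rho> \<beta>) (germ_pt \<beta> ` {0..\<rho> \<beta>})"
        using arm by auto
      from trav_trans[OF trav_trans[OF this(2) trav_sym[OF this(2)]] this(1)]
      show ?case using insert by simp
    qed
    have BD: "B D \<in> \<Gamma>" "\<delta> D = germ_pt (B D) (P D)" "P D \<in> {0..r}" using BP[of D] D by auto
    have "trav (germ_pt (B D) (\<rho> (B D))) (germ_pt (B D) (P D)) \<bar>\<rho> (B D) - P D\<bar>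
        (germ_pt (B D) ` {min (\<rho> (B D)) (P D)..max (\<rho> (B D)) (P D)})"
      using BD(1,3) \<rho>[OF BD(1)] by (intro trav_germ[of _ x0 r]) (simp_all add: \<Gamma>_def r_def)
    then have home: "trav (germ_pt (B D) (\<rho> (B D))) (\<delta> D) (\<rho> (B D) - P D) {}"
      using P_le[of D] D BD(2) trav_mono by fastforce
    \<comment> \<open>The branch containing the end point is visited last, so that its return trip
      can stop at \<open>P D\<close>.\<close>
    define A where "A = \<Gamma> - {B D}"
    have A: "finite A" "A \<subseteq> \<Gamma>" "\<Gamma> = insert (B D) A" "B D \<notin> A" using fin BD(1) by (auto simp: A_def)
    have "(\<Sum>\<beta>\<in>A. 2 * \<rho> \<beta>) + \<rho> (B D) + (\<rho> (B D) - P D) = (\<Sum>\<beta>\<in>\<Gamma>. 2 * \<rho> \<beta>) - P D"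
      using A(1,4) by (simp add: A(3))
    moreover have "(\<Union>\<beta>\<in>A. germ_pt \<beta> ` {0..\<rho> \<beta>}) \<union> germ_pt (B D) ` {0..\<rho> (B D)} \<union> {} = (\<Union>\<beta>\<in>\<Gamma>. germ_pt \<beta> ` {0..\<rho> \<beta>})"
      unfolding A(3) by blast
    ultimately have "trav x0 (\<delta> D) ((\<Sum>\<beta>\<in>\<Gamma>. 2 * \<rho> \<beta>) - P D) (\<Union>\<beta>\<in>\<Gamma>. germ_pt \<beta> ` {0..\<rho> \<beta>})"
      using trav_trans[OF trav_trans[OF arms[OF A(1,2)] arm[OF BD(1)]] home] by (simp only:)
    moreover have "\<delta> ` {0..D} \<subseteq> (\<Union>\<beta>\<in>\<Gamma>. germ_pt \<beta> ` {0..\<rho> \<beta>})"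
    proof (rule image_subsetI)
      fix x assume x: "x \<in> {0..D}"
      have "B x \<in> \<Gamma>" "P x \<in> {0..\<rho> (B x)}" "\<delta> x = germ_pt (B x) (P x)" using BP[OF x] P_le[OF x] by auto
      then show "\<delta> x \<in> (\<Union>\<beta>\<in>\<Gamma>. germ_pt \<beta> ` {0..\<rho> \<beta>})" by blast
    qed
    ultimately show ?thesis using total trav_mono by blast
  qed
qed

text \<open>Star radii tend to 0 on approaching a vertex along an edge, so no uniform step length is
  available; bisection chooses the centres \<open>u\<close> where the local replacement is
  made.\<close>

lemma path_trav:
  assumes pts: "\<And>x. x \<in> {0..c} \<Longrightarrow> \<gamma> x \<in> pts"
    and lip: "\<And>x y. x \<in> {0..c} \<Longrightarrow> y \<in> {0..c} \<Longrightarrow> gd (\<gamma> x) (\<gamma> y) \<le> ereal \<bar>x - y\<bar>"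
    and "0 \<le> c"
  shows "\<exists>k\<le>c. trav (\<gamma> 0) (\<gamma> c) k (\<gamma> ` {0..c})"
proof -
  define Q where "Q s t \<longleftrightarrow> 0 \<le> s \<longrightarrow> t \<le> c \<longrightarrow> (\<exists>k\<le>t - s. trav (\<gamma> s) (\<gamma> t) k (\<gamma> ` {s..t}))" for s t
  have "Q 0 c"
    using \<open>0 \<le> c\<close>
  proof (induction rule: Bolzano)
    case (trans s t u)
    show ?case
      unfolding Q_def
    proof (intro impI)
      assume "0 \<le> s" "u \<le> c"
      then obtain k k' where "k \<le> t - s" "trav (\<gamma> s) (\<gamma> t) k (\<gamma> ` {s..t})" "k' \<le> u - t" "trav (\<gamma> t) (\<gamma> u) k' (\<gamma> ` {t..u})"
        using trans by (force simp: Q_def)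
      moreover have "\<gamma> ` {s..u} = \<gamma> ` {s..t} \<union> \<gamma> ` {t..u}"
        using trans by (simp add: ivl_disj_un_two_touch(4) flip: image_Un)
      ultimately show "\<exists>k\<le>u - s. trav (\<gamma> s) (\<gamma> u) k (\<gamma> ` {s..u})"
        using trav_trans by (intro exI[of _ "k + k'"]) auto
    qed
  next
    case (local u)
    then have u: "\<gamma> u \<in> pts" using pts by auto
    have "\<exists>k\<le>t - s. trav (\<gamma> s) (\<gamma> t) k (\<gamma> ` {s..t})"
      if "s \<le> u" "u \<le> t" "t - s < star_radius (\<gamma> u)" "0 \<le> s" "t \<le> c" for s t
    proof -
      \<comment> \<open>The local replacement needs a path that starts at the centre of the star.
        The left half is therefore run backwards from \<open>u\<close>, and its trail is
        reversed.\<close>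
      have "\<exists>k\<le>u - s. trav (\<gamma> u) (\<gamma> (u - (u - s))) k ((\<lambda>x. \<gamma> (u - x)) ` {0..u - s})"
      proof (rule short_path_trav[OF u])
        fix x y assume "x \<in> {0..u - s}" "y \<in> {0..u - s}"
        then show "gd (\<gamma> (u - x)) (\<gamma> (u - y)) \<le> ereal \<bar>x - y\<bar>"
          using lip[of "u - x" "u - y"] that by (simp add: abs_minus_commute)
      qed (use that in \<open>auto intro: pts\<close>)
      then obtain k where k: "k \<le> u - s" "trav (\<gamma> u) (\<gamma> s) k ((\<lambda>x. \<gamma> (u - x)) ` {0..u - s})" by auto
      have "\<exists>k\<le>t - u. trav (\<gamma> u) (\<gamma> (u + (t - u))) k ((\<lambda>x. \<gamma> (u + x)) ` {0..t - u})"
      proof (rule short_path_trav[OF u])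
        fix x y assume "x \<in> {0..t - u}" "y \<in> {0..t - u}"
        then show "gd (\<gamma> (u + x)) (\<gamma> (u + y)) \<le> ereal \<bar>x - y\<bar>"
          using lip[of "u + x" "u + y"] that by simp
      qed (use that in \<open>auto intro: pts\<close>)
      then obtain k' where k': "k' \<le> t - u" "trav (\<gamma> u) (\<gamma> t) k' ((\<lambda>x. \<gamma> (u + x)) ` {0..t - u})" by auto
      have "\<gamma> ` {s..t} \<subseteq> ((\<lambda>x. \<gamma> (u - x)) ` {0..u - s}) \<union> ((\<lambda>x. \<gamma> (u + x)) ` {0..t - u})"
      proof (rule image_subsetI)
        fix x assume "x \<in> {s..t}"
        then show "\<gamma> x \<in> ((\<lambda>x. \<gamma> (u - x)) ` {0..u - s}) \<union> ((\<lambda>x. \<gamma> (u + x)) ` {0..t - u})"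
          using image_eqI[of "\<gamma> x" "\<lambda>x. \<gamma> (u - x)" "u - x"] image_eqI[of "\<gamma> x" "\<lambda>x. \<gamma> (u + x)" "x - u"]
          by (cases "x \<le> u") auto
      qed
      then show ?thesis using k k' trav_mono[OF trav_trans[OF trav_sym[OF k(2)] k'(2)]]
        by (intro exI[of _ "k + k'"]) auto
    qed
    then show ?case unfolding Q_def using star_radius_pos[OF u] by blast
  qed
  then show ?thesis by (simp add: Q_def)
qed

end

subsection \<open>Perturbation\<close>

text \<open>Over the rationals, \<open>1\<close> and an irrational \<open>\<alpha>\<close> are linearly independent vectors of \<open>\<real>\<close>.\<close>

lemma additive_functional:
  fixes \<alpha> :: real
  assumes "\<alpha> \<notin> \<rat>"
  obtains \<psi> :: "real \<Rightarrow> real" where "\<And>x y. \<psi> (x + y) = \<psi> x + \<psi> y" "\<psi> 1 = 0" "\<psi> \<alpha> = -1"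
proof -
  interpret Q: vector_space_pair "\<lambda>(q::rat) (x::real). of_rat q * x" "\<lambda>(q::rat) (x::real). of_rat q * x"
    by unfold_locales (auto simp: algebra_simps of_rat_add of_rat_mult)
  have "\<alpha> \<notin> Q.vs1.span {1}"
    using assms unfolding Q.vs1.span_singleton Rats_def by auto
  then have "Q.vs1.independent {\<alpha>, 1}"
    by (intro Q.vs1.independent_insertI) (simp_all add: Q.vs1.independent_empty)
  from Q.linear_independent_extend[OF this, of "\<lambda>x. if x = \<alpha> then -1 else 0"]
  obtain \<psi> where \<psi>: "Vector_Spaces.linear (\<lambda>(q::rat) (x::real). of_rat q * x) (\<lambda>(q::rat) (x::real). of_rat q * x) \<psi>"
    "\<forall>x\<in>{\<alpha>, 1}. \<psi> x = (if x = \<alpha> then -1 else 0)"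
    by auto
  show ?thesis
  proof
    show "\<psi> (x + y) = \<psi> x + \<psi> y" for x y by (rule Q.linear_add[OF \<psi>(1)])
    show "\<psi> 1 = 0" "\<psi> \<alpha> = -1" using \<psi>(2) assms Rats_1 by auto
  qed
qed

text \<open>Nothing is known about \<theta> off \<open>Z\<close>, so points cannot be pulled back.
  Instead \<open>y\<close> is caught between the images of neighbours \<open>p < q\<close> in
  \<open>Z\<close>. An interval of the cover that contains their midpoint has its ends in
  \<open>Z\<close>, hence contains both neighbours, and by monotonicity on \<open>Z\<close> its
  image interval contains \<open>y\<close>.\<close>

lemma perturbed_cover:
  fixes \<theta> :: "real \<Rightarrow> real"
  assumes Z: "finite Z" "Z \<subseteq> {a..b}" "a \<in> Z" "b \<in> Z" and mono: "strict_mono_on Z \<theta>"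
    and I: "I \<subseteq> Z \<times> Z" and cover: "\<And>y. y \<in> {a<..<b} \<Longrightarrow> \<exists>(s, t)\<in>I. min s t \<le> y \<and> y \<le> max s t"
    and y: "\<theta> a < y" "y < \<theta> b"
  shows "\<exists>(s, t)\<in>I. min (\<theta> s) (\<theta> t) \<le> y \<and> y \<le> max (\<theta> s) (\<theta> t)"
proof -
  define p where "p = Max {z \<in> Z. \<theta> z \<le> y}"
  define q where "q = Min {z \<in> Z. y < \<theta> z}"
  have "p \<in> {z \<in> Z. \<theta> z \<le> y}" unfolding p_def by (rule Max_in) (use Z y in auto)
  then have p: "p \<in> Z" "\<theta> p \<le> y" by auto
  have p_max: "z \<le> p" if "z \<in> Z" "\<theta> z \<le> y" for z
    unfolding p_def by (rule Max_ge) (use Z that in auto)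
  have "q \<in> {z \<in> Z. y < \<theta> z}" unfolding q_def by (rule Min_in) (use Z y in auto)
  then have q: "q \<in> Z" "y < \<theta> q" by auto
  have q_min: "q \<le> z" if "z \<in> Z" "y < \<theta> z" for z
    unfolding q_def by (rule Min_le) (use Z that in auto)
  have "p < q" using strict_mono_on_leD[OF mono q(1) p(1)] p q by (meson le_less_trans not_le)
  then have "(p + q) / 2 \<in> {a<..<b}" using p q Z by (auto simp: field_simps)
  then obtain s t where st: "(s, t) \<in> I" "min s t \<le> (p + q) / 2" "(p + q) / 2 \<le> max s t"
    using cover by blast
  then have "s \<in> Z" "t \<in> Z" using I by auto
  have "\<theta> (min s t) \<le> y"
    using q_min[of "min s t"] st \<open>p < q\<close> \<open>s \<in> Z\<close> \<open>t \<in> Z\<close> by (cases "\<theta> (min s t) \<le> y") (auto simp: min_def split: if_splits)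
  moreover have "y \<le> \<theta> (max s t)"
    using p_max[of "max s t"] st \<open>p < q\<close> \<open>s \<in> Z\<close> \<open>t \<in> Z\<close> by (cases "y \<le> \<theta> (max s t)") (auto simp: max_def split: if_splits)
  ultimately show ?thesis using st(1) by (intro bexI[of _ "(s, t)"]) (auto simp: min_def max_def split: if_splits)
qed

section \<open>Points and trails under a change of coordinates\<close>

primrec move :: "(real \<Rightarrow> real) \<Rightarrow> ('v, 'e) gpt \<Rightarrow> ('v, 'e) gpt" where
  "move \<theta> (Vert v) = Vert v"
| "move \<theta> (EdgePt f t) = EdgePt f (\<theta> t)"

definition perturb :: "(real \<Rightarrow> real) \<Rightarrow> ('e \<times> real \<times> real) list \<Rightarrow> ('e \<times> real \<times> real) list" where
  "perturb \<theta> ts = map (\<lambda>(f, s, t). (f, \<theta> s, \<theta> t)) ts"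

definition coords :: "('e \<times> real \<times> real) list \<Rightarrow> real set" where
  "coords ts = (\<Union>(f, s, t)\<in>set ts. {s, t})"

lemma finite_coords: "finite (coords ts)"
  by (auto simp: coords_def)

lemma perturb_Nil_iff [simp]: "perturb \<theta> ts = [] \<longleftrightarrow> ts = []"
  by (simp add: perturb_def)

context equilateral_graph
begin

lemma coords_trail: "trail x ts y \<Longrightarrow> coords ts \<subseteq> {0..L}"
  by (induction x ts y rule: trail.induct) (auto simp: coords_def)

text \<open>As the order on \<open>Z\<close> is kept, every absolute value is resolved with the same
  sign before and after. The length is thus an integer combination of coordinates, and additivity of
  \<psi> passes through it.\<close>

lemma trail_length_perturb:
  assumes add: "\<And>x y. \<psi> (x + y) = \<psi> x + \<psi> y"
    and mono: "strict_mono_on Z (\<lambda>t. t + \<epsilon> * \<psi> t)" and "coords ts \<subseteq> Z"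
  shows "trail_length (perturb (\<lambda>t. t + \<epsilon> * \<psi> t) ts) = trail_length ts + \<epsilon> * \<psi> (trail_length ts)"
  using assms(3)
proof (induction ts)
  case Nil
  have "\<psi> 0 = 0" using add[of 0 0] by simp
  then show ?case by (simp add: trail_length_def perturb_def)
next
  case (Cons q ts)
  obtain f s t where q: "q = (f, s, t)" by (cases q)
  have Z: "s \<in> Z" "t \<in> Z" using Cons.prems q by (auto simp: coords_def)
  have diff: "\<psi> (x - y) = \<psi> x - \<psi> y" for x y using add[of "x - y" y] by simp
  have "\<bar>(s + \<epsilon> * \<psi> s) - (t + \<epsilon> * \<psi> t)\<bar> = \<bar>s - t\<bar> + \<epsilon> * \<psi> \<bar>s - t\<bar>"
  proof (cases "s \<le> t")
    case True
    then have "s + \<epsilon> * \<psi> s \<le> t + \<epsilon> * \<psi> t" using strict_mono_on_leD[OF mono Z] by simp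
    then show ?thesis using True by (simp add: diff algebra_simps)
  next
    case False
    then have "t + \<epsilon> * \<psi> t \<le> s + \<epsilon> * \<psi> s" using strict_mono_on_leD[OF mono Z(2,1)] by simp
    then show ?thesis using False by (simp add: diff algebra_simps)
  qed
  moreover have "coords ts \<subseteq> Z" using Cons.prems by (auto simp: coords_def)
  ultimately show ?case using Cons.IH
    by (simp add: trail_length_def perturb_def q add algebra_simps)
qed

context
  fixes \<theta> :: "real \<Rightarrow> real" and Z :: "real set"
  assumes mono: "strict_mono_on Z \<theta>" and ends: "0 \<in> Z" "L \<in> Z" "\<theta> 0 = 0" "\<theta> L = L"
begin

lemma perturbed_interior: "t \<in> Z \<Longrightarrow> 0 < t \<Longrightarrow> t < L \<Longrightarrow> 0 < \<theta> t \<and> \<theta> t < L"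
  using strict_mono_onD[OF mono, of 0 t] strict_mono_onD[OF mono, of t L] ends by auto

lemma perturbed_range: "t \<in> Z \<Longrightarrow> t \<in> {0..L} \<Longrightarrow> \<theta> t \<in> {0..L}"
  using perturbed_interior[of t] ends L_pos by (cases "t = 0 \<or> t = L") auto

lemma move_pos: "t \<in> Z \<Longrightarrow> t \<in> {0..L} \<Longrightarrow> move \<theta> (pos f t) = pos f (\<theta> t)"
  using perturbed_interior[of t] ends pos_interior[of t f] pos_interior[of "\<theta> t" f]
  by (cases "t = 0 \<or> t = L") auto

lemma move_in_pts: "x \<in> pts \<Longrightarrow> (\<And>f t. x = EdgePt f t \<Longrightarrow> t \<in> Z) \<Longrightarrow> move \<theta> x \<in> pts"
  using perturbed_interior by (cases x) (auto simp: gpoints_def)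

lemma trail_perturb:
  "\<lbrakk>trail x ts y; coords ts \<subseteq> Z; move \<theta> y \<in> pts\<rbrakk> \<Longrightarrow> trail (move \<theta> x) (perturb \<theta> ts) (move \<theta> y)"
proof (induction x ts y rule: trail.induct)
  case (2 x f s t ts y)
  then have "s \<in> Z" "t \<in> Z" "coords ts \<subseteq> Z" by (auto simp: coords_def)
  then show ?case using 2 move_pos[of s f] move_pos[of t f] perturbed_range[of s] perturbed_range[of t]
    by (simp add: perturb_def)
qed (simp add: perturb_def)

lemma seg_perturb_subset: "(f, s, t) \<in> set ts \<Longrightarrow> seg f (\<theta> s) (\<theta> t) \<subseteq> trace x (perturb \<theta> ts)"
  by (force simp: trace_def perturb_def)

text \<open>A segment inside \<open>[0, L]\<close> meets a vertex only at its own ends, where the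
  coordinate is 0 or \<open>L\<close> and is fixed by \<theta>.\<close>

lemma Vert_in_trace_perturb:
  assumes "trail x ts y" "Vert w \<in> trace x ts"
  shows "Vert w \<in> trace (move \<theta> x) (perturb \<theta> ts)"
proof (cases "x = Vert w")
  case True
  then show ?thesis by (simp add: trace_def)
next
  case False
  then obtain f s t z where z: "(f, s, t) \<in> set ts" "pos f z = Vert w" "z \<in> {min s t..max s t}"
    using assms(2) by (force simp: trace_def seg_def)
  have st: "s \<in> {0..L}" "t \<in> {0..L}" using coords_trail[OF assms(1)] z(1) by (force simp: coords_def)+
  then have zr: "z \<in> {0..L}" using z(3) by auto
  then have "z = 0 \<or> z = L" using z(2) pos_eq_Vert by blast
  then have "z = s \<or> z = t" "\<theta> z = z" using z(3) st ends by auto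
  then have "pos f z \<in> seg f (\<theta> s) (\<theta> t)" using pos_in_seg by metis
  then show ?thesis using seg_perturb_subset[OF z(1)] z(2) by auto
qed

end

end

subsection \<open>Isometric coverings and paths\<close>

lemma variation_abs_le:
  assumes "sorted ts" "set ts \<subseteq> {0..1}" "0 \<le> k"
  shows "variation (\<lambda>a b. ereal (k * \<bar>a - b\<bar>)) ts \<le> ereal k"
proof -
  have "variation (\<lambda>a b. ereal (k * \<bar>a - b\<bar>)) (a # ts) \<le> ereal (k * (1 - a))"
    if "sorted (a # ts)" "set (a # ts) \<subseteq> {0..1}" for a ts
    using that
  proof (induction ts arbitrary: a)
    case Nil
    then show ?case using \<open>0 \<le> k\<close> by simp
  next
    case (Cons b ts)
    have "variation (\<lambda>a b. ereal (k * \<bar>a - b\<bar>)) (a # b # ts) \<le> ereal (k * \<bar>a - b\<bar>) + ereal (k * (1 - b))"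
      unfolding variation_simps by (rule add_left_mono, rule Cons.IH) (use Cons.prems in auto)
    also have "\<dots> = ereal (k * (1 - a))" using Cons.prems by (simp add: algebra_simps)
    finally show ?case .
  qed
  note * = this
  show ?thesis
  proof (cases ts)
    case (Cons a us)
    then have "variation (\<lambda>a b. ereal (k * \<bar>a - b\<bar>)) ts \<le> ereal (k * (1 - a))" using * assms by auto
    also have "\<dots> \<le> ereal k" using assms Cons by (simp add: mult_left_le)
    finally show ?thesis .
  qed (use assms in simp)
qed

lemma variation_le_arclen:
  "sorted ts \<Longrightarrow> set ts \<subseteq> {0..1} \<Longrightarrow> variation (\<lambda>a b. gdist G l (p a) (p b)) ts \<le> arclen G l p"
  unfolding arclen_variation by (auto intro: SUP_upper)

lemma gdist_le_arclen: "a \<in> {0..1} \<Longrightarrow> b \<in> {0..1} \<Longrightarrow> a \<le> b \<Longrightarrow> gdist G l (p a) (p b) \<le> arclen G l p"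
  using variation_le_arclen[of "[a, b]" G l p] by simp

context equilateral_graph
begin

text \<open>Coverings are tested on paths over the unit interval, so a piece of an edge is traversed
  at constant speed \<open>\<bar>s - t\<bar>\<close>.\<close>

lemma affine_path:
  assumes f: "f \<in> edges G" and st: "s \<in> {0..L}" "t \<in> {0..L}"
  defines "p \<equiv> \<lambda>u. pos f (s + u * (t - s))"
  shows "gpath G (\<lambda>_. L) p" "arclen G (\<lambda>_. L) p \<le> ereal \<bar>s - t\<bar>"
proof -
  have rng: "s + u * (t - s) \<in> {0..L}" if "u \<in> {0..1}" for u
  proof -
    have "s + u * (t - s) = (1 - u) * s + u * t" by (simp add: algebra_simps)
    moreover have "(1 - u) * s + u * t \<le> (1 - u) * L + u * L" using that st by (intro add_mono mult_left_mono) auto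
    moreover have "0 \<le> (1 - u) * s + u * t" using that st by auto
    ultimately show ?thesis by (simp add: algebra_simps)
  qed
  have lip: "gd (p u) (p v) \<le> ereal (\<bar>s - t\<bar> * \<bar>u - v\<bar>)" if "u \<in> {0..1}" "v \<in> {0..1}" for u v
  proof -
    have "\<bar>(s + u * (t - s)) - (s + v * (t - s))\<bar> = \<bar>s - t\<bar> * \<bar>u - v\<bar>"
    proof -
      have "(s + u * (t - s)) - (s + v * (t - s)) = (t - s) * (u - v)" by (simp add: algebra_simps)
      then show ?thesis by (simp add: abs_mult abs_minus_commute)
    qed
    then show ?thesis using gd_le_step[OF f rng[OF that(1)] rng[OF that(2)]] by (simp add: p_def)
  qed
  show "gpath G (\<lambda>_. L) p"
    unfolding gpath_def
  proof (intro conjI ballI allI impI)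
    show "p ` {0..1} \<subseteq> pts" using pos_in_pts[OF f] by (auto simp: p_def)
    fix u :: real and e :: real assume u: "u \<in> {0..1}" and e: "e > 0"
    show "\<exists>\<delta>>0. \<forall>v\<in>{0..1}. \<bar>v - u\<bar> < \<delta> \<longrightarrow> gd (p v) (p u) < ereal e"
    proof (intro exI conjI ballI impI)
      show "e / (\<bar>s - t\<bar> + 1) > 0" using e by simp
      fix v :: real assume v: "v \<in> {0..1}" "\<bar>v - u\<bar> < e / (\<bar>s - t\<bar> + 1)"
      have "\<bar>s - t\<bar> * \<bar>v - u\<bar> \<le> (\<bar>s - t\<bar> + 1) * \<bar>v - u\<bar>" by (intro mult_right_mono) auto
      also have "\<dots> < e" using v(2) by (simp add: pos_less_divide_eq mult.commute)
      finally show "gd (p v) (p u) < ereal e" using lip[OF v(1) u] by (simp add: le_less_trans)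
    qed
  qed
  show "arclen G (\<lambda>_. L) p \<le> ereal \<bar>s - t\<bar>"
    unfolding arclen_variation
  proof (rule SUP_least)
    fix ts :: "real list" assume ts: "ts \<in> {ts. sorted ts \<and> set ts \<subseteq> {0..1}}"
    then have "variation (\<lambda>a b. gd (p a) (p b)) ts \<le> variation (\<lambda>a b. ereal (\<bar>s - t\<bar> * \<bar>a - b\<bar>)) ts"
      by (intro variation_mono lip) auto
    also have "\<dots> \<le> ereal \<bar>s - t\<bar>" using ts by (intro variation_abs_le) auto
    finally show "variation (\<lambda>a b. gd (p a) (p b)) ts \<le> ereal \<bar>s - t\<bar>" .
  qed
qed

end

locale two_graphs = X: equilateral_graph G K + Y: equilateral_graph H L
  for G :: "('v, 'e) graph" and K :: real and H :: "('w, 'f) graph" and L :: real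
begin

text \<open>Distance is at most the arc length of the image path, which equals that of the piece of
  the edge.\<close>

lemma iso_cover_lipschitz:
  assumes m: "iso_cover G (\<lambda>_. K) H (\<lambda>_. L) m"
    and f: "f \<in> edges G" "s \<in> {0..K}" "t \<in> {0..K}"
  shows "Y.gd (m (X.pos f s)) (m (X.pos f t)) \<le> ereal \<bar>s - t\<bar>"
proof -
  define p where "p = (\<lambda>u. X.pos f (s + u * (t - s)))"
  note p = X.affine_path[OF f, folded p_def]
  have "Y.gd ((m \<circ> p) 0) ((m \<circ> p) 1) \<le> arclen H (\<lambda>_. L) (m \<circ> p)" by (rule gdist_le_arclen) auto
  also have "\<dots> = arclen G (\<lambda>_. K) p" using m p(1) by (simp add: iso_cover_def)
  also have "\<dots> \<le> ereal \<bar>s - t\<bar>" by (rule p(2))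
  finally show ?thesis by (simp add: p_def)
qed

text \<open>A constant image has arc length 0, whereas the edge has positive arc length already near
  its start. This later excludes empty trails, which could not be padded.\<close>

lemma iso_cover_not_constant:
  assumes m: "iso_cover G (\<lambda>_. K) H (\<lambda>_. L) m" and f: "f \<in> edges G"
  shows "\<exists>t\<in>{0..K}. m (X.pos f t) \<noteq> x"
proof (rule ccontr)
  assume "\<not> ?thesis"
  then have const: "m (X.pos f t) = x" if "t \<in> {0..K}" for t using that by blast
  have K: "0 < K" by (rule X.L_pos)
  define p where "p = (\<lambda>u. X.pos f (0 + u * (K - 0)))"
  have p: "gpath G (\<lambda>_. K) p"
    unfolding p_def by (rule X.affine_path(1)[OF f]) (use K in auto)
  have mp: "(m \<circ> p) u = x" if "u \<in> {0..1}" for u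
    using const[of "u * K"] that K by (simp add: p_def mult_left_le_one_le)
  have x: "x \<in> Y.pts" using m const[of 0] X.pos_in_pts[OF f, of 0] K by (force simp: iso_cover_def)
  have zero: "arclen H (\<lambda>_. L) (m \<circ> p) \<le> 0"
    unfolding arclen_variation
  proof (rule SUP_least)
    fix ts :: "real list" assume ts: "ts \<in> {ts. sorted ts \<and> set ts \<subseteq> {0..1}}"
    then have "variation (\<lambda>a b. Y.gd ((m \<circ> p) a) ((m \<circ> p) b)) ts \<le> variation (\<lambda>a b. ereal (0 * \<bar>a - b\<bar>)) ts"
      by (intro variation_mono) (use mp Y.gd_refl[OF x] in \<open>auto simp: subset_iff\<close>)
    also have "\<dots> \<le> ereal 0" using ts by (intro variation_abs_le) auto
    finally show "variation (\<lambda>a b. Y.gd ((m \<circ> p) a) ((m \<circ> p) b)) ts \<le> 0" by (simp add: zero_ereal_def)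
  qed
  obtain r where r: "r > 0" "\<forall>s\<in>{0..K}. \<bar>s - 0\<bar> < r \<longrightarrow> ereal \<bar>s - 0\<bar> \<le> X.gd (X.pos f s) (X.pos f 0)"
    using X.gd_pos_near[OF f, of 0] K by auto
  define s where "s = min (r / 2) K"
  have s: "0 < s" "s \<le> K" "s < r" using r(1) K by (auto simp: s_def)
  have "ereal s \<le> X.gd (p (s / K)) (p 0)" using r(2)[rule_format, of s] s K by (simp add: p_def)
  also have "\<dots> = X.gd (p 0) (p (s / K))" by (rule X.gd_sym)
  also have "\<dots> \<le> arclen G (\<lambda>_. K) p" using s K by (intro gdist_le_arclen) auto
  also have "\<dots> \<le> 0" using zero m p by (simp add: iso_cover_def)
  finally show False using s by (simp add: zero_ereal_def)
qed

text \<open>The glued map does not increase distances, hence not arc lengths. The converse needs,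
  around each point \<open>x\<close>, that distances to \<open>x\<close> are not decreased by the
  map. Each branch of the star at \<open>x\<close> runs along one edge, where unit speed gives
  exactly this. The argument needs no rectifiability: both arc lengths may be infinite.\<close>

lemma iso_cover_of_paths:
  assumes \<mu>: "\<And>v. v \<in> verts G \<Longrightarrow> \<mu> v \<in> Y.pts"
    and g: "\<And>e. e \<in> edges G \<Longrightarrow> Y.unit_speed (g e) K"
    and g0: "\<And>e. e \<in> edges G \<Longrightarrow> g e 0 = \<mu> (src G e)"
    and gK: "\<And>e. e \<in> edges G \<Longrightarrow> g e K = \<mu> (tgt G e)"
    and cover: "Y.pts \<subseteq> \<mu> ` verts G \<union> (\<Union>e\<in>edges G. g e ` {0..K})"
  shows "\<exists>m. iso_cover G (\<lambda>_. K) H (\<lambda>_. L) m"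
proof -
  define m where "m x = (case x of Vert v \<Rightarrow> \<mu> v | EdgePt e t \<Rightarrow> g e t)" for x
  have m_pos: "m (X.pos e t) = g e t" if "e \<in> edges G" "t \<in> {0..K}" for e t
    using that g0 gK X.pos_interior[of t e] by (cases "t = 0 \<or> t = K") (auto simp: m_def)
  have m_lip: "Y.gd (m x) (m y) \<le> X.gd x y" if "x \<in> X.pts" for x y
  proof -
    have m_pts: "m x \<in> Y.pts" if "x \<in> X.pts" for x
      using that \<mu> Y.unit_speed_pts[OF g] by (auto simp: m_def gpoints_def[of G])
    have "X.chain x y c \<Longrightarrow> Y.gd (m x) (m y) \<le> ereal c" for c
    proof (induction rule: gchain.induct)
      case (refl x)
      then show ?case using Y.gd_refl[OF m_pts] by (simp add: zero_ereal_def)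
    next
      case (step e s t z c)
      have "Y.gd (m (X.pos e s)) (m z) \<le> Y.gd (m (X.pos e s)) (m (X.pos e t)) + Y.gd (m (X.pos e t)) (m z)"
        by (rule Y.gd_triangle)
      also have "\<dots> \<le> ereal \<bar>s - t\<bar> + ereal c"
        using step Y.unit_speed_lipschitz[OF g, of e s t] by (intro add_mono) (auto simp: m_pos)
      finally show ?case by simp
    qed
    then show ?thesis unfolding gdist_def[of G] by (auto intro!: Inf_greatest)
  qed
  have image: "m ` X.pts = Y.pts"
  proof
    show "m ` X.pts \<subseteq> Y.pts" using \<mu> Y.unit_speed_pts[OF g] by (auto simp: m_def gpoints_def[of G])
    have "\<mu> v \<in> m ` X.pts" if "v \<in> verts G" for v
      using that by (intro image_eqI[of _ _ "Vert v"]) (auto simp: m_def gpoints_def)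
    moreover have "g e t \<in> m ` X.pts" if "e \<in> edges G" "t \<in> {0..K}" for e t
      using that m_pos X.pos_in_pts by (metis imageI)
    ultimately show "Y.pts \<subseteq> m ` X.pts" using cover by blast
  qed
  have "arclen H (\<lambda>_. L) (m \<circ> p) = arclen G (\<lambda>_. K) p" if p: "gpath G (\<lambda>_. K) p" for p
  proof (rule antisym)
    have pp: "p u \<in> X.pts" if "u \<in> {0..1}" for u using p that by (auto simp: gpath_def)
    show "arclen H (\<lambda>_. L) (m \<circ> p) \<le> arclen G (\<lambda>_. K) p"
      unfolding arclen_variation
    proof (rule SUP_subset_mono[OF subset_refl], rule variation_mono)
      fix ts :: "real list" and s t assume "ts \<in> {ts. sorted ts \<and> set ts \<subseteq> {0..1}}" "s \<in> set ts"
      then have "s \<in> {0..1}" by auto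
      then show "Y.gd ((m \<circ> p) s) ((m \<circ> p) t) \<le> X.gd (p s) (p t)" using m_lip[OF pp] by simp
    qed
    show "arclen G (\<lambda>_. K) p \<le> arclen H (\<lambda>_. L) (m \<circ> p)"
      unfolding arclen_variation
    proof (rule SUP_variation_le)
      fix u :: real assume u: "u \<in> {0..1}"
      define x where "x = p u"
      have x: "x \<in> X.pts" using pp[OF u] by (simp add: x_def)
      have "\<exists>r>0. \<forall>\<rho>\<in>{0..X.star_radius x}. \<rho> < r \<longrightarrow> ereal \<rho> \<le> Y.gd (m (X.germ_pt \<beta> \<rho>)) (m x)"
        if \<beta>: "\<beta> \<in> X.star_germs x" for \<beta>
      proof -
        obtain e t \<sigma> where [simp]: "\<beta> = (e, t, \<sigma>)" by (cases \<beta>)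
        have e: "e \<in> edges G" "t \<in> {0..K}" "X.pos e t = x" "\<bar>\<sigma>\<bar> = 1" using \<beta> by (auto simp: X.germs_def)
        obtain r where r: "r > 0" "\<And>s. s \<in> {0..K} \<Longrightarrow> \<bar>s - t\<bar> < r \<Longrightarrow> ereal \<bar>s - t\<bar> \<le> Y.gd (g e s) (g e t)"
          using Y.unit_speed_local[OF g[OF e(1)] e(2)] by blast
        show ?thesis
        proof (intro exI conjI ballI impI)
          fix \<rho> assume \<rho>: "\<rho> \<in> {0..X.star_radius x}" "\<rho> < r"
          have rng: "t + \<sigma> * \<rho> \<in> {0..K}" using X.germ_range \<beta> \<rho> by auto
          have "ereal \<rho> \<le> Y.gd (g e (t + \<sigma> * \<rho>)) (g e t)"
            using r(2)[OF rng] \<rho> e(4) by (simp add: abs_mult)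
          then show "ereal \<rho> \<le> Y.gd (m (X.germ_pt \<beta> \<rho>)) (m x)"
            using m_pos[OF e(1) rng] m_pos[OF e(1,2)] e(3) by (simp add: X.germ_pt_def)
        qed (rule r(1))
      qed
      then have "\<forall>\<beta>\<in>X.star_germs x. \<exists>r>0. \<forall>\<rho>\<in>{0..X.star_radius x}. \<rho> < r \<longrightarrow> ereal \<rho> \<le> Y.gd (m (X.germ_pt \<beta> \<rho>)) (m x)"
        by blast
      from bchoice[OF this] obtain r where r: "\<And>\<beta>. \<beta> \<in> X.star_germs x \<Longrightarrow> r \<beta> > 0"
        "\<And>\<beta> \<rho>. \<beta> \<in> X.star_germs x \<Longrightarrow> \<rho> \<in> {0..X.star_radius x} \<Longrightarrow> \<rho> < r \<beta> \<Longrightarrow> ereal \<rho> \<le> Y.gd (m (X.germ_pt \<beta> \<rho>)) (m x)"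
        by blast
      \<comment> \<open>The minimum over the finitely many germs gives one radius for all branches;
        including the star radius ensures that nearby points lie on a branch at all.\<close>
      define R where "R = Min (insert (X.star_radius x) (r ` X.star_germs x))"
      have fin: "finite (insert (X.star_radius x) (r ` X.star_germs x))" by (simp add: X.finite_star_germs)
      have "R > 0" unfolding R_def using fin r(1) X.star_radius_pos[OF x] by (subst Min_gr_iff) auto
      have R: "R \<le> X.star_radius x" "\<And>\<beta>. \<beta> \<in> X.star_germs x \<Longrightarrow> R \<le> r \<beta>"
        unfolding R_def using fin by auto
      obtain \<delta> where \<delta>: "\<delta> > 0" "\<And>v. v \<in> {0..1} \<Longrightarrow> \<bar>v - u\<bar> < \<delta> \<Longrightarrow> X.gd (p v) (p u) < ereal R"
        using p u \<open>R > 0\<close> unfolding gpath_def by metis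
      have "X.gd (p v) x \<le> Y.gd (m (p v)) (m x)" if v: "v \<in> {0..1}" "\<bar>v - u\<bar> < \<delta>" for v
      proof -
        have near: "X.gd (p v) x < ereal R" using \<delta>(2)[OF v] by (simp add: x_def)
        also have "\<dots> \<le> ereal (X.star_radius x)" using R(1) by simp
        finally consider "p v = x" | \<beta> \<rho> where "\<beta> \<in> X.star_germs x" "0 \<le> \<rho>" "\<rho> < X.star_radius x" "p v = X.germ_pt \<beta> \<rho>"
          using X.near_star[OF x pp[OF v(1)]] by blast
        then show ?thesis
        proof cases
          case 1
          then show ?thesis using X.gd_refl[OF x] Y.gd_nonneg by simp
        next
          case 2
          have "ereal \<rho> \<le> X.gd (p v) x" using X.gd_germ_pt_centre[OF x 2(1), of \<rho>] 2 by simp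
          then have "\<rho> < R" using near ereal_between_less by blast
          have "X.gd (p v) x \<le> ereal \<rho>"
          proof -
            have "X.chain (X.germ_pt \<beta> \<rho>) (X.germ_pt \<beta> 0) \<rho>"
            proof -
              obtain e t \<sigma> where [simp]: "\<beta> = (e, t, \<sigma>)" by (cases \<beta>)
              have "e \<in> edges G" "\<bar>\<sigma>\<bar> = 1" "t \<in> {0..K}" using 2(1) by (auto simp: X.germs_def)
              then show ?thesis
                using X.chain_step[of e "t + \<sigma> * \<rho>" "t + \<sigma> * 0"] X.germ_range[of e t \<sigma> x "X.star_radius x"] 2 X.star_radius_pos[OF x]
                by (simp add: X.germ_pt_def abs_mult)
            qed
            then show ?thesis using X.gd_le_chain X.germ_pt_0[OF 2(1)] 2(4) by metis
          qed
          also have "\<dots> \<le> Y.gd (m (p v)) (m x)" using r(2)[OF 2(1), of \<rho>] R(2)[OF 2(1)] \<open>\<rho> < R\<close> 2 by simp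
          finally show ?thesis .
        qed
      qed
      then show "\<exists>\<delta>>0. \<forall>v\<in>{0..1}. \<bar>v - u\<bar> < \<delta> \<longrightarrow> X.gd (p v) (p u) \<le> Y.gd ((m \<circ> p) v) ((m \<circ> p) u)"
        using \<delta>(1) by (auto simp: x_def)
    qed (fact X.gd_triangle X.gd_sym Y.gd_sym)+
  qed
  then show ?thesis using image by (auto simp: iso_cover_def)
qed

end

section \<open>Shrinking an irrational scale factor\<close>

lemma tendsto_perturb: "((\<lambda>\<epsilon>. a + \<epsilon> * b) \<longlongrightarrow> a) (at_right (0::real))" for a b :: real
  by (auto intro!: tendsto_eq_intros)

lemma eventually_perturb_less:
  fixes a b c d :: real
  assumes "a < c"
  shows "\<forall>\<^sub>F \<epsilon> in at_right 0. a + \<epsilon> * b < c + \<epsilon> * d"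
proof -
  have "((\<lambda>\<epsilon>. (c + \<epsilon> * d) - (a + \<epsilon> * b)) \<longlongrightarrow> c - a) (at_right 0)"
    by (intro tendsto_diff tendsto_perturb)
  from order_tendstoD(1)[OF this, of 0] show ?thesis using assms by simp
qed

lemma irrational_cover_shrinks:
  fixes G :: "('v, 'e) graph" and H :: "('w, 'f) graph"
  assumes "finite_graph G" "finite_graph H" and \<alpha>: "\<alpha> > 0" "\<alpha> \<notin> \<rat>"
    and m: "iso_cover G (\<lambda>_. \<alpha>) H (\<lambda>_. 1) m"
  shows "\<exists>a m'. 0 < a \<and> a < \<alpha> \<and> iso_cover G (\<lambda>_. a) H (\<lambda>_. 1) m'"
proof -
  interpret two_graphs G \<alpha> H 1
    by unfold_locales (use assms in auto)
  define \<mu> where "\<mu> v = m (Vert v)" for v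
  have m_pts: "m x \<in> Y.pts" if "x \<in> X.pts" for x using m that by (auto simp: iso_cover_def)
  have ends: "src G e \<in> verts G" "tgt G e \<in> verts G" if "e \<in> edges G" for e
    using X.fin that by (auto simp: finite_graph_def)
  have \<mu>: "\<mu> v \<in> Y.pts" if "v \<in> verts G" for v using m_pts that by (auto simp: \<mu>_def gpoints_def[of G])
  have "\<exists>ts. Y.trail (\<mu> (src G e)) ts (\<mu> (tgt G e)) \<and> Y.trail_length ts \<le> \<alpha> \<and>
      (\<lambda>t. m (X.pos e t)) ` {0..\<alpha>} \<subseteq> Y.trace (\<mu> (src G e)) ts" if e: "e \<in> edges G" for e
  proof -
    have "\<exists>k\<le>\<alpha>. Y.trav (m (X.pos e 0)) (m (X.pos e \<alpha>)) k ((\<lambda>t. m (X.pos e t)) ` {0..\<alpha>})"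
      using \<alpha>(1) iso_cover_lipschitz[OF m e] by (intro Y.path_trav m_pts X.pos_in_pts[OF e]) auto
    then show ?thesis by (auto simp: Y.trav_def \<mu>_def)
  qed
  then obtain T where T: "\<And>e. e \<in> edges G \<Longrightarrow> Y.trail (\<mu> (src G e)) (T e) (\<mu> (tgt G e))"
    "\<And>e. e \<in> edges G \<Longrightarrow> Y.trail_length (T e) \<le> \<alpha>"
    "\<And>e. e \<in> edges G \<Longrightarrow> (\<lambda>t. m (X.pos e t)) ` {0..\<alpha>} \<subseteq> Y.trace (\<mu> (src G e)) (T e)"
    by metis
  have T_ne: "T e \<noteq> []" if e: "e \<in> edges G" for e
    using T(3)[OF e] iso_cover_not_constant[OF m e, of "\<mu> (src G e)"] by (auto simp: Y.trace_def image_subset_iff)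
  define coord :: "('w, 'f) gpt \<Rightarrow> real" where "coord x = (case x of Vert w \<Rightarrow> 0 | EdgePt f t \<Rightarrow> t)" for x
  \<comment> \<open>The images of vertices are listed separately, because an isolated vertex of
    \<open>G\<close> may be sent into the interior of an edge without appearing in any trail. The
    value 0 of \<open>coord\<close> at vertices is harmless, as 0 belongs to \<open>Z\<close>
    already.\<close>
  define Z where "Z = {0, 1} \<union> (\<Union>e\<in>edges G. coords (T e)) \<union> (coord \<circ> \<mu>) ` verts G"
  have Z_fin: "finite Z"
    using X.fin by (auto simp: Z_def finite_coords finite_graph_def)
  have coord: "coord (\<mu> v) \<in> {0..1}" if "v \<in> verts G" for v
    using \<mu>[OF that] by (auto simp: coord_def gpoints_def)
  have Z: "Z \<subseteq> {0..1}" using Y.coords_trail[OF T(1)] coord by (auto simp: Z_def subset_iff)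
  have TZ: "coords (T e) \<subseteq> Z" if "e \<in> edges G" for e using that by (auto simp: Z_def)
  have \<mu>Z: "t \<in> Z" if "v \<in> verts G" "\<mu> v = EdgePt f t" for v f t
    using that by (auto simp: Z_def coord_def intro!: image_eqI[of _ _ v])
  obtain \<psi> :: "real \<Rightarrow> real" where \<psi>: "\<And>x y. \<psi> (x + y) = \<psi> x + \<psi> y" "\<psi> 1 = 0" "\<psi> \<alpha> = -1"
    using additive_functional[OF \<alpha>(2)] by blast
  have "\<psi> 0 = 0" using \<psi>(1)[of 0 0] by simp
  have "\<forall>\<^sub>F \<epsilon> in at_right 0. \<forall>s\<in>Z. \<forall>t\<in>Z. s < t \<longrightarrow> s + \<epsilon> * \<psi> s < t + \<epsilon> * \<psi> t"
  \<comment> \<open>Each strict inequality survives for small \<epsilon> however large the values of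
    \<psi> are, and there are finitely many pairs.\<close>
  proof (intro eventually_ball_finite Z_fin ballI)
    fix s t show "\<forall>\<^sub>F \<epsilon> in at_right 0. s < t \<longrightarrow> s + \<epsilon> * \<psi> s < t + \<epsilon> * \<psi> t"
      using eventually_perturb_less by (cases "s < t") simp_all
  qed
  moreover have "\<forall>\<^sub>F \<epsilon> in at_right 0. \<forall>e\<in>edges G. Y.trail_length (T e) + \<epsilon> * \<psi> (Y.trail_length (T e)) \<le> \<alpha> + \<epsilon> * \<psi> \<alpha>"
  proof (intro eventually_ball_finite X.finite_edges ballI)
    fix e assume "e \<in> edges G"
    then have "Y.trail_length (T e) \<le> \<alpha>" by (rule T(2))
    show "\<forall>\<^sub>F \<epsilon> in at_right 0. Y.trail_length (T e) + \<epsilon> * \<psi> (Y.trail_length (T e)) \<le> \<alpha> + \<epsilon> * \<psi> \<alpha>"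
    \<comment> \<open>A tight constraint stays an equality, since \<psi> is evaluated at the same
      number on both sides; a strict one survives for small \<epsilon>.\<close>
    proof (cases "Y.trail_length (T e) = \<alpha>")
      case False
      then have "Y.trail_length (T e) < \<alpha>" using \<open>Y.trail_length (T e) \<le> \<alpha>\<close> by simp
      then show ?thesis by (rule eventually_mono[OF eventually_perturb_less less_imp_le])
    qed simp
  qed
  moreover have "\<forall>\<^sub>F \<epsilon> in at_right 0. 0 < \<alpha> + \<epsilon> * \<psi> \<alpha>"
    using eventually_perturb_less[of 0 \<alpha> 0 "\<psi> \<alpha>"] \<alpha> by simp
  moreover have "\<forall>\<^sub>F \<epsilon> in at_right (0::real). 0 < \<epsilon>" by (rule eventually_at_right_less)
  ultimately have "\<forall>\<^sub>F \<epsilon> in at_right 0. (\<forall>s\<in>Z. \<forall>t\<in>Z. s < t \<longrightarrow> s + \<epsilon> * \<psi> s < t + \<epsilon> * \<psi> t) \<and>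
      (\<forall>e\<in>edges G. Y.trail_length (T e) + \<epsilon> * \<psi> (Y.trail_length (T e)) \<le> \<alpha> + \<epsilon> * \<psi> \<alpha>) \<and>
      0 < \<alpha> + \<epsilon> * \<psi> \<alpha> \<and> 0 < \<epsilon>"
    by eventually_elim blast
  then obtain \<epsilon> where \<epsilon>: "\<And>s t. s \<in> Z \<Longrightarrow> t \<in> Z \<Longrightarrow> s < t \<Longrightarrow> s + \<epsilon> * \<psi> s < t + \<epsilon> * \<psi> t"
    "\<And>e. e \<in> edges G \<Longrightarrow> Y.trail_length (T e) + \<epsilon> * \<psi> (Y.trail_length (T e)) \<le> \<alpha> + \<epsilon> * \<psi> \<alpha>"
    "0 < \<alpha> + \<epsilon> * \<psi> \<alpha>" "0 < \<epsilon>"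
    using eventually_happens'[OF trivial_limit_at_right_real] by blast
  define \<theta> where "\<theta> t = t + \<epsilon> * \<psi> t" for t
  define a where "a = \<alpha> - \<epsilon>"
  have a: "0 < a" "a < \<alpha>" using \<epsilon>(3,4) \<psi>(3) by (auto simp: a_def)
  have mono: "strict_mono_on Z \<theta>" using \<epsilon>(1) by (auto simp: strict_mono_on_def \<theta>_def)
  have Z01: "0 \<in> Z" "1 \<in> Z" "\<theta> 0 = 0" "\<theta> 1 = 1" using \<psi>(2) \<open>\<psi> 0 = 0\<close> by (auto simp: Z_def \<theta>_def)
  \<comment> \<open>Vertex images are moved by the same \<theta> as the trails, so the perturbed
    trails of edges sharing a vertex still meet there.\<close>
  define \<nu> where "\<nu> v = move \<theta> (\<mu> v)" for v
  have \<nu>: "\<nu> v \<in> Y.pts" if "v \<in> verts G" for v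
    unfolding \<nu>_def using Y.move_in_pts[OF mono Z01 \<mu>[OF that]] \<mu>Z[OF that] by blast
  have "Y.reach (\<nu> (src G e)) (\<nu> (tgt G e)) a (Y.trace (\<nu> (src G e)) (perturb \<theta> (T e)))" if e: "e \<in> edges G" for e
    unfolding \<nu>_def
  proof (rule Y.reach_trail_padded)
    show "Y.trail (move \<theta> (\<mu> (src G e))) (perturb \<theta> (T e)) (move \<theta> (\<mu> (tgt G e)))"
      using Y.trail_perturb[OF mono Z01 T(1)[OF e] TZ[OF e]] \<nu>[OF ends(2)[OF e]] by (simp add: \<nu>_def)
    show "perturb \<theta> (T e) \<noteq> []" using T_ne[OF e] by simp
    show "Y.trail_length (perturb \<theta> (T e)) \<le> a"
      using Y.trail_length_perturb[OF \<psi>(1) mono[unfolded \<theta>_def] TZ[OF e]] \<epsilon>(2)[OF e] \<psi>(3)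
      by (simp add: \<theta>_def[abs_def] a_def)
  qed
  then have "\<forall>e\<in>edges G. \<exists>h. Y.unit_speed h a \<and> h 0 = \<nu> (src G e) \<and> h a = \<nu> (tgt G e) \<and>
      Y.trace (\<nu> (src G e)) (perturb \<theta> (T e)) \<subseteq> h ` {0..a}"
    unfolding Y.reach_def by blast
  from bchoice[OF this] obtain g where g: "\<And>e. e \<in> edges G \<Longrightarrow> Y.unit_speed (g e) a"
    "\<And>e. e \<in> edges G \<Longrightarrow> g e 0 = \<nu> (src G e)" "\<And>e. e \<in> edges G \<Longrightarrow> g e a = \<nu> (tgt G e)"
    and g_trace: "\<And>e. e \<in> edges G \<Longrightarrow> Y.trace (\<nu> (src G e)) (perturb \<theta> (T e)) \<subseteq> g e ` {0..a}"
    by blast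
  have m_cases: "(\<exists>v\<in>verts G. y = \<mu> v) \<or> (\<exists>e\<in>edges G. y \<in> Y.trace (\<mu> (src G e)) (T e))" if y: "y \<in> Y.pts" for y
  proof -
    obtain x where x: "x \<in> X.pts" "y = m x" using y m by (auto simp: iso_cover_def)
    show ?thesis
    proof (cases x)
      case (Vert v)
      then have "v \<in> verts G" "y = \<mu> v" using x by (auto simp: \<mu>_def gpoints_def)
      then show ?thesis by blast
    next
      case (EdgePt e t)
      then have "e \<in> edges G" "t \<in> {0..\<alpha>}" "y = m (X.pos e t)"
        using x X.pos_interior by (auto simp: gpoints_def)
      then show ?thesis using T(3) by blast
    qed
  qed
  \<comment> \<open>Surjectivity is recovered in two ways: vertices of \<open>H\<close> are fixed by
    the perturbation, while each open edge is covered anew by the moved intervals.\<close>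
  have "y \<in> \<nu> ` verts G \<union> (\<Union>e\<in>edges G. Y.trace (\<nu> (src G e)) (perturb \<theta> (T e)))" if y: "y \<in> Y.pts" for y
  proof (cases y)
    case (Vert w)
    show ?thesis using m_cases[OF y]
    proof
      assume "\<exists>v\<in>verts G. y = \<mu> v"
      then obtain v where v: "v \<in> verts G" "\<mu> v = Vert w" using Vert by auto
      then have "y = \<nu> v" using Vert by (simp add: \<nu>_def)
      then show ?thesis using v(1) by blast
    next
      assume "\<exists>e\<in>edges G. y \<in> Y.trace (\<mu> (src G e)) (T e)"
      then obtain e where e: "e \<in> edges G" "Vert w \<in> Y.trace (\<mu> (src G e)) (T e)" using Vert by blast
      have "y \<in> Y.trace (\<nu> (src G e)) (perturb \<theta> (T e))"
        unfolding \<nu>_def Vert by (rule Y.Vert_in_trace_perturb[OF mono Z01 T(1)[OF e(1)] e(2)])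
      then show ?thesis using e(1) by blast
    qed
  next
    case (EdgePt f u)
    then have u: "f \<in> edges H" "0 < u" "u < 1" using y by (auto simp: gpoints_def)
    \<comment> \<open>Vertex images on \<open>f\<close> enter as degenerate intervals, so that every
      point of the open edge is covered before the perturbation, including one supplied only by an
      isolated vertex of \<open>G\<close>.\<close>
    define I where "I = {(s, t). \<exists>e\<in>edges G. (f, s, t) \<in> set (T e)} \<union> {(t, t) |t. \<exists>v\<in>verts G. \<mu> v = EdgePt f t}"
    have "\<exists>(s, t)\<in>I. min (\<theta> s) (\<theta> t) \<le> u \<and> u \<le> max (\<theta> s) (\<theta> t)"
    proof (rule perturbed_cover[OF Z_fin Z Z01(1,2) mono])
      have "s \<in> Z \<and> t \<in> Z" if "e \<in> edges G" "(f, s, t) \<in> set (T e)" for e s t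
        using TZ[OF that(1)] that(2) unfolding coords_def by blast
      then show "I \<subseteq> Z \<times> Z" using \<mu>Z by (auto simp: I_def)
      fix z :: real assume z: "z \<in> {0<..<1}"
      then have z_pts: "EdgePt f z \<in> Y.pts" using u by (auto simp: gpoints_def)
      have at_vertex: "\<exists>(s, t)\<in>I. min s t \<le> z \<and> z \<le> max s t" if "v \<in> verts G" "EdgePt f z = \<mu> v" for v
      proof -
        have "(z, z) \<in> I" unfolding I_def using that(1) that(2)[symmetric] by blast
        then show ?thesis by (intro bexI[of _ "(z, z)"]) auto
      qed
      have on_trace: "\<exists>(s, t)\<in>I. min s t \<le> z \<and> z \<le> max s t"
        if e: "e \<in> edges G" and z_trace: "EdgePt f z \<in> Y.trace (\<mu> (src G e)) (T e)" "EdgePt f z \<noteq> \<mu> (src G e)" for e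
      proof -
        obtain q where "q \<in> set (T e)" "EdgePt f z \<in> (case q of (f', s, t) \<Rightarrow> Y.seg f' s t)"
          using z_trace unfolding Y.trace_def by blast
        then obtain f' s t where *: "(f', s, t) \<in> set (T e)" and "EdgePt f z \<in> Y.seg f' s t"
          by (auto split: prod.splits)
        from this(2) obtain z' where z': "z' \<in> {min s t..max s t}" "EdgePt f z = Y.pos f' z'"
          unfolding Y.seg_def by blast
        have "{s, t} \<subseteq> coords (T e)" using * unfolding coords_def by blast
        then have "s \<in> {0..1}" "t \<in> {0..1}" using Y.coords_trail[OF T(1)[OF e]] by auto
        then have "z' \<in> {0..1}" using z'(1) by auto
        then have "f' = f" "z' = z" using z'(2) Y.pos_eq_EdgePt[of z' f' f z] by auto
        then have "(s, t) \<in> I" unfolding I_def using * e by blast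
        then show ?thesis using z'(1) \<open>z' = z\<close> by (intro bexI[of _ "(s, t)"]) auto
      qed
      from m_cases[OF z_pts] show "\<exists>(s, t)\<in>I. min s t \<le> z \<and> z \<le> max s t"
      proof
        assume "\<exists>v\<in>verts G. EdgePt f z = \<mu> v"
        then show ?thesis using at_vertex by blast
      next
        assume "\<exists>e\<in>edges G. EdgePt f z \<in> Y.trace (\<mu> (src G e)) (T e)"
        then obtain e where e: "e \<in> edges G" "EdgePt f z \<in> Y.trace (\<mu> (src G e)) (T e)" by blast
        show ?thesis
        proof (cases "EdgePt f z = \<mu> (src G e)")
          case True
          then show ?thesis by (rule at_vertex[OF ends(1)[OF e(1)]])
        next
          case False
          then show ?thesis by (rule on_trace[OF e])
        qed
      qed
    qed (use u Z01 in auto)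
    then obtain s t where st: "(s, t) \<in> I" "u \<in> {min (\<theta> s) (\<theta> t)..max (\<theta> s) (\<theta> t)}" by auto
    from st(1) have "(\<exists>e\<in>edges G. (f, s, t) \<in> set (T e)) \<or> (s = t \<and> (\<exists>v\<in>verts G. \<mu> v = EdgePt f t))"
      unfolding I_def by fastforce
    then consider e where "e \<in> edges G" "(f, s, t) \<in> set (T e)" | v where "s = t" "v \<in> verts G" "\<mu> v = EdgePt f t"
      by blast
    then show ?thesis
    proof cases
      case 1
      have "y = Y.pos f u" using EdgePt u Y.pos_interior by simp
      then have "y \<in> Y.seg f (\<theta> s) (\<theta> t)" using st(2) by (auto simp: Y.seg_def)
      then have "y \<in> Y.trace (\<nu> (src G e)) (perturb \<theta> (T e))"
        using Y.seg_perturb_subset[OF mono Z01 1(2)] by blast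
      then show ?thesis using 1(1) by blast
    next
      case 2
      then have "y = \<nu> v" using st(2) EdgePt by (simp add: \<nu>_def)
      then show ?thesis using 2 by blast
    qed
  qed
  then have "Y.pts \<subseteq> \<nu> ` verts G \<union> (\<Union>e\<in>edges G. Y.trace (\<nu> (src G e)) (perturb \<theta> (T e)))" by (rule subsetI)
  also have "\<dots> \<subseteq> \<nu> ` verts G \<union> (\<Union>e\<in>edges G. g e ` {0..a})"
    by (intro Un_mono UN_mono subset_refl g_trace)
  finally have cover: "Y.pts \<subseteq> \<nu> ` verts G \<union> (\<Union>e\<in>edges G. g e ` {0..a})" .
  interpret S: two_graphs G a H 1
    by unfold_locales (use assms a in auto)
  have "\<exists>m'. iso_cover G (\<lambda>_. a) H (\<lambda>_. 1) m'"
    by (rule S.iso_cover_of_paths[OF \<nu> g cover])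
  then show ?thesis using a by blast
qed

theorem theorem4:
  fixes G1 :: "('v1, 'e1) graph" and G2 :: "('v2, 'e2) graph" and \<alpha> :: real
  assumes "finite_graph G1" and "finite_graph G2"
    and "\<alpha> > 0" and "\<exists>m. iso_cover G1 (\<lambda>_. \<alpha>) G2 (\<lambda>_. 1) m"
    and "\<And>a. a > 0 \<Longrightarrow> (\<exists>m. iso_cover G1 (\<lambda>_. a) G2 (\<lambda>_. 1) m) \<Longrightarrow> \<alpha> \<le> a"
  shows "\<alpha> \<in> \<rat>"
  using irrational_cover_shrinks[OF assms(1-3)] assms(4,5) by (meson not_le)

end
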